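(* A timelike rotational surface $M$ in $\mathbb{E}^4_1$ defined by $r(s,t)=(x(s)\cos at,\ x(s)\sin at,\ w(s)\sinh bt,\ w(s)\cosh bt)$ with flat normal bundle has pointwise 1-type Gauss map of the second kind if and only if $M$ is an open part of a timelike plane in $\mathbb{E}^4_1$.
   Context: $\mathbb{E}^4_1$ is $\mathbb{R}^4$ with the metric $g=dx_1^2+dx_2^2+dx_3^2-dx_4^2$, and $\langle\cdot,\cdot\rangle$ is the associated indefinite inner product. Rotational surface (called a double rotational surface): $\gamma(s)=(x(s),0,0,w(s))$ is a profile curve in the timelike $xw$-plane, defined on an open interval and parametrized by arc length $s$, with $x'(s)^2-w'(s)^2=-1$; the timelike rotational surface is $r(s,t)=(x(s)\cos at,\ x(s)\sin at,\ w(s)\sinh bt,\ w(s)\cosh bt)$, $t\in(0,2\pi)$, where $a,b$ are real constants. Timelike means that the induced metric is Lorentzian; a timelike plane is a 2-plane with Lorentzian induced metric. Flat normal bundle means that the normal curvature tensor $R^D$ (curvature of the normal connection $D$) vanishes identically. Let $\{e_1,e_2,e_3,e_4\}$ be an oriented local orthonormal frame with $e_1,e_2$ tangent and $e_3,e_4$ normal to $M$, $\varepsilon_A=\langle e_A,e_A\rangle=\pm1$. The Gauss map is $\nu=e_3\wedge e_4$, viewed as a map from $M$ into $\Lambda^2\mathbb{E}^4_1\cong\mathbb{E}^6_s$ (a pseudo-Euclidean space for the inner product induced on $\Lambda^2$ by determinants). The Laplacian on $M$ is $\Delta=\sum_{i=1}^2\varepsilon_i(\nabla_{e_i}e_i-e_ie_i)$,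 where $\nabla$ is the induced connection of $M$, applied componentwise to vector-valued maps. $M$ has pointwise 1-type Gauss map if $\Delta\nu=f(\nu+C)$ for some smooth function $f$ on $M$ and some constant vector $C\in\Lambda^2\mathbb{E}^4_1$; it is of the first kind if $C=0$, and of the second kind otherwise. Convention: a plane (for which $\nu$ is constant and $\Delta\nu=0$) is regarded as trivially having pointwise 1-type Gauss map both of the first kind (with $f=0$) and of the second kind (with $C=-\nu$ and any nonzero smooth function $f$).
   Formalization: The constants a and b are both assumed nonzero; if exactly one of them is zero, timelike cones x = s sinh θ, w = s cosh θ (θ ≠ 0) have flat normal bundle and pointwise 1-type Gauss map of the second kind without being planes. *)

theory Defs
  imports "HOL-Analysis.Analysis"
begin

section \<open>Smooth maps\<close>

text \<open>On an open set, a map is of class $C^k$ iff it can be differentiated $k$ times in arbitrary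
  directions, being Frechet differentiable before each differentiation, with a continuous result.\<close>

primrec Ck_on :: "nat \<Rightarrow> 'a::real_normed_vector set \<Rightarrow> ('a \<Rightarrow> 'b::real_normed_vector) \<Rightarrow> bool" where
  "Ck_on 0 U f \<longleftrightarrow> continuous_on U f"
| "Ck_on (Suc k) U f \<longleftrightarrow>
     (\<forall>p\<in>U. f differentiable (at p)) \<and> (\<forall>v. Ck_on k U (\<lambda>p. frechet_derivative f (at p) v))"

definition smooth_on :: "'a::real_normed_vector set \<Rightarrow> ('a \<Rightarrow> 'b::real_normed_vector) \<Rightarrow> bool" where
  "smooth_on U f \<longleftrightarrow> (\<forall>k. Ck_on k U f)"


section \<open>Minkowski space and its bivectors\<close>

definition lor :: "real^4 \<Rightarrow> real^4 \<Rightarrow> real" where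
  "lor u v = u$1 * v$1 + u$2 * v$2 + u$3 * v$3 - u$4 * v$4"

text \<open>The exterior square of $R^4$ is realized as the 6-dimensional space of skew-symmetric
  matrices; the entries $(i,j)$ with $i<j$ are the Pluecker coordinates.\<close>

definition bivectors :: "(real^4^4) set" where
  "bivectors = {B. transpose B = - B}"

definition wedge :: "real^4 \<Rightarrow> real^4 \<Rightarrow> real^4^4" where
  "wedge u v = (\<chi> i j. u$i * v$j - u$j * v$i)"

definition lorentzian_2dim :: "(real^4) set \<Rightarrow> bool" where
  "lorentzian_2dim V \<longleftrightarrow> subspace V \<and> dim V = 2 \<and>
     (\<exists>u\<in>V. \<exists>v\<in>V. lor u u = -1 \<and> lor v v = 1 \<and> lor u v = 0)"

definition timelike_plane :: "(real^4) set \<Rightarrow> bool" where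
  "timelike_plane P \<longleftrightarrow> (\<exists>c V. lorentzian_2dim V \<and> P = (+) c ` V)"

definition open_part_of_timelike_plane :: "(real^4) set \<Rightarrow> bool" where
  "open_part_of_timelike_plane M \<longleftrightarrow> (\<exists>P. timelike_plane P \<and> openin (top_of_set P) M)"


section \<open>Parametrized surfaces\<close>

text \<open>A surface is a map \<open>r\<close> on an open set of parameters in $R^2$. Tangent vectors and
  tangent vector fields are represented in the parameter plane; \<open>push r X\<close> is the corresponding
  field along the surface with values in Minkowski space. Functions on the surface are functions of
  the parameters.\<close>

definition push :: "(real \<times> real \<Rightarrow> real^4) \<Rightarrow> (real \<times> real \<Rightarrow> real \<times> real) \<Rightarrow> real \<times> real \<Rightarrow> real^4" where
  "push r X p = frechet_derivative r (at p) (X p)"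

definition along ::
  "(real \<times> real \<Rightarrow> real \<times> real) \<Rightarrow> (real \<times> real \<Rightarrow> 'a::real_normed_vector) \<Rightarrow> real \<times> real \<Rightarrow> 'a" where
  "along X F p = frechet_derivative F (at p) (X p)"

definition tangent_space :: "(real \<times> real \<Rightarrow> real^4) \<Rightarrow> real \<times> real \<Rightarrow> (real^4) set" where
  "tangent_space r p = range (frechet_derivative r (at p))"

definition normal_space :: "(real \<times> real \<Rightarrow> real^4) \<Rightarrow> real \<times> real \<Rightarrow> (real^4) set" where
  "normal_space r p = {n. \<forall>v\<in>tangent_space r p. lor n v = 0}"

definition timelike_surface :: "(real \<times> real) set \<Rightarrow> (real \<times> real \<Rightarrow> real^4) \<Rightarrow> bool" where
  "timelike_surface U r \<longleftrightarrow> smooth_on U r \<and> (\<forall>p\<in>U. lorentzian_2dim (tangent_space r p))"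

text \<open>Orthogonal decomposition into tangential and normal part. It exists and is unique wherever
  \<open>r\<close> is an immersion with nondegenerate induced metric.\<close>

definition tangent_part :: "(real \<times> real \<Rightarrow> real^4) \<Rightarrow> real \<times> real \<Rightarrow> real^4 \<Rightarrow> real \<times> real" where
  "tangent_part r p v = (THE Z. v - frechet_derivative r (at p) Z \<in> normal_space r p)"

definition normal_part :: "(real \<times> real \<Rightarrow> real^4) \<Rightarrow> real \<times> real \<Rightarrow> real^4 \<Rightarrow> real^4" where
  "normal_part r p v = v - frechet_derivative r (at p) (tangent_part r p v)"

definition induced_conn ::
  "(real \<times> real \<Rightarrow> real^4) \<Rightarrow> (real \<times> real \<Rightarrow> real \<times> real) \<Rightarrow> (real \<times> real \<Rightarrow> real \<times> real)
     \<Rightarrow> real \<times> real \<Rightarrow> real \<times> real" where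
  "induced_conn r X Y p = tangent_part r p (along X (push r Y) p)"

definition normal_conn ::
  "(real \<times> real \<Rightarrow> real^4) \<Rightarrow> (real \<times> real \<Rightarrow> real \<times> real) \<Rightarrow> (real \<times> real \<Rightarrow> real^4)
     \<Rightarrow> real \<times> real \<Rightarrow> real^4" where
  "normal_conn r X \<xi> p = normal_part r p (along X \<xi> p)"

definition bracket ::
  "(real \<times> real \<Rightarrow> real \<times> real) \<Rightarrow> (real \<times> real \<Rightarrow> real \<times> real) \<Rightarrow> real \<times> real \<Rightarrow> real \<times> real" where
  "bracket X Y p = along X Y p - along Y X p"

definition normal_curv ::
  "(real \<times> real \<Rightarrow> real^4) \<Rightarrow> (real \<times> real \<Rightarrow> real \<times> real) \<Rightarrow> (real \<times> real \<Rightarrow> real \<times> real)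
     \<Rightarrow> (real \<times> real \<Rightarrow> real^4) \<Rightarrow> real \<times> real \<Rightarrow> real^4" where
  "normal_curv r X Y \<xi> p =
     normal_conn r X (normal_conn r Y \<xi>) p - normal_conn r Y (normal_conn r X \<xi>) p
     - normal_conn r (bracket X Y) \<xi> p"

definition flat_normal_bundle :: "(real \<times> real) set \<Rightarrow> (real \<times> real \<Rightarrow> real^4) \<Rightarrow> bool" where
  "flat_normal_bundle U r \<longleftrightarrow>
     (\<forall>X Y \<xi>. smooth_on U X \<and> smooth_on U Y \<and> smooth_on U \<xi> \<and> (\<forall>p\<in>U. \<xi> p \<in> normal_space r p)
        \<longrightarrow> (\<forall>p\<in>U. normal_curv r X Y \<xi> p = 0))"


section \<open>Frames, Laplacian and Gauss map\<close>

text \<open>The tangent fields \<open>E1\<close>, \<open>E2\<close> live in the parameter plane, so the frame itself is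
  \<open>push r E1, push r E2, e3, e4\<close>. Both the frame and its tangent part are required to be positively
  oriented (for the standard orientations of $R^4$ and of the parameter plane): only then is the
  sign of $e_3 \wedge e_4$ determined by the surface. Reversing the orientation of the surface
  replaces the Gauss map by its negative.\<close>

definition oriented_frame ::
  "(real \<times> real) set \<Rightarrow> (real \<times> real \<Rightarrow> real^4) \<Rightarrow> (real \<times> real \<Rightarrow> real \<times> real) \<Rightarrow> (real \<times> real \<Rightarrow> real \<times> real)
     \<Rightarrow> (real \<times> real \<Rightarrow> real^4) \<Rightarrow> (real \<times> real \<Rightarrow> real^4) \<Rightarrow> bool" where
  "oriented_frame V r E1 E2 e3 e4 \<longleftrightarrow>
     smooth_on V E1 \<and> smooth_on V E2 \<and> smooth_on V e3 \<and> smooth_on V e4 \<and>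
     (\<forall>p\<in>V.
        \<bar>lor (push r E1 p) (push r E1 p)\<bar> = 1 \<and> \<bar>lor (push r E2 p) (push r E2 p)\<bar> = 1 \<and>
        lor (push r E1 p) (push r E2 p) = 0 \<and>
        e3 p \<in> normal_space r p \<and> e4 p \<in> normal_space r p \<and>
        \<bar>lor (e3 p) (e3 p)\<bar> = 1 \<and> \<bar>lor (e4 p) (e4 p)\<bar> = 1 \<and> lor (e3 p) (e4 p) = 0 \<and>
        fst (E1 p) * snd (E2 p) - snd (E1 p) * fst (E2 p) > 0 \<and>
        det (vector [push r E1 p, push r E2 p, e3 p, e4 p] :: real^4^4) > 0)"

definition laplacian ::
  "(real \<times> real \<Rightarrow> real^4) \<Rightarrow> (real \<times> real \<Rightarrow> real \<times> real) \<Rightarrow> (real \<times> real \<Rightarrow> real \<times> real)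
     \<Rightarrow> (real \<times> real \<Rightarrow> 'a::real_normed_vector) \<Rightarrow> real \<times> real \<Rightarrow> 'a" where
  "laplacian r E1 E2 F p =
     lor (push r E1 p) (push r E1 p) *\<^sub>R (along (induced_conn r E1 E1) F p - along E1 (along E1 F) p)
   + lor (push r E2 p) (push r E2 p) *\<^sub>R (along (induced_conn r E2 E2) F p - along E2 (along E2 F) p)"

text \<open>The equation $\Delta\nu = f(\nu + C)$, required in every oriented local orthonormal
  frame, with \<open>f\<close> and \<open>C\<close> independent of the frame.\<close>

definition gauss_map_eq ::
  "(real \<times> real) set \<Rightarrow> (real \<times> real \<Rightarrow> real^4) \<Rightarrow> (real \<times> real \<Rightarrow> real) \<Rightarrow> real^4^4 \<Rightarrow> bool" where
  "gauss_map_eq U r f C \<longleftrightarrow>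
     (\<forall>V E1 E2 e3 e4. open V \<and> V \<subseteq> U \<and> oriented_frame V r E1 E2 e3 e4 \<longrightarrow>
        (let \<nu> = (\<lambda>p. wedge (e3 p) (e4 p))
         in \<forall>p\<in>V. laplacian r E1 E2 \<nu> p = f p *\<^sub>R (\<nu> p + C)))"

definition pointwise_1_type_second_kind :: "(real \<times> real) set \<Rightarrow> (real \<times> real \<Rightarrow> real^4) \<Rightarrow> bool" where
  "pointwise_1_type_second_kind U r \<longleftrightarrow>
     (\<exists>f C. smooth_on U f \<and> C \<in> bivectors \<and> C \<noteq> 0 \<and> gauss_map_eq U r f C)"


section \<open>Double rotational surfaces\<close>

definition double_rot ::
  "real \<Rightarrow> real \<Rightarrow> (real \<Rightarrow> real) \<Rightarrow> (real \<Rightarrow> real) \<Rightarrow> real \<times> real \<Rightarrow> real^4" where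
  "double_rot a b x w = (\<lambda>(s, t).
     vector [x s * cos (a * t), x s * sin (a * t), w s * sinh (b * t), w s * cosh (b * t)])"

end

theory Submission
  imports Defs
begin

text \<open>Rotating the profile curve gives an adapted orthonormal frame whose structure equations have
  coefficients depending on \<open>s\<close> only: \<open>c\<close>, \<open>\<beta>\<close>, \<open>\<mu>\<close> from the second fundamental form, \<open>\<rho>\<close> and \<open>\<kappa>\<close> from
  the tangential and normal connections. The Ricci equation turns the flatness of the normal bundle into
  \<open>\<mu> (c + \<beta>) = 0\<close>. Comparing components of $\Delta\nu = f(\nu + C)$, and differentiating the
  vanishing components of the constant $C$, forces \<open>\<kappa> (\<mu>\<^sup>2 + c\<^sup>2) = 0\<close> wherever \<open>\<mu>\<close> is nonzero, which leads to
  $C = 0$ or to a profile curve with $w = 0$. So \<open>\<mu>\<close> vanishes identically and $x = k w$; a nonzero $k$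
  would make \<open>\<rho> \<kappa> \<beta>\<close> nonzero, contradicting the same relations. Conversely, over a plane the normal space is
  constant, hence $\nu$ has derivative zero and $f = 0$ works with every $C$.\<close>

section \<open>Smooth maps\<close>

text \<open>The obstacle is that \<open>f\<close> may have zeros, where the equation carries no
  information about \<open>C\<close>. At a zero of \<open>f\<close> the coefficients of the
  Laplacian vanish outright; elsewhere \<open>f\<close> is nonzero nearby by continuity, and the
  linear relations between the components of \<open>C\<close>, multiplied by \<open>f\<close>, turn
  into relations between the structure coefficients alone. For
  \<open>\<kappa> (\<mu>\<^sup>2 + c\<^sup>2) = 0\<close> the two cases give the same conclusion, so
  it holds without knowing where \<open>f\<close> vanishes. Flatness gives only a product, hence
  \<open>c + \<beta> = 0\<close> just on the open set where \<mu> is nonzero. Openness permits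
  differentiating there, and a profile with \<open>w = 0\<close> on an open set is absurd because
  \<open>w1\<^sup>2 = 1 + x1\<^sup>2\<close>. The line \<open>x = k w\<close> arises because
  \<open>q\<^sup>2 \<mu>\<close> is \<open>a b\<close> times the Wronskian
  \<open>x w1 - w x1\<close>. On such a line \<open>c = 0\<close>, so
  \<open>\<beta>\<^sup>2 = f (1 + C34)\<close> with \<beta> nonzero forces \<open>f\<close> to be
  nonzero, and the relations for \<open>C\<close> become available.\<close>

lemma frechet_derivative_cong_open:
  assumes "open U" "p \<in> U" "\<And>y. y \<in> U \<Longrightarrow> f y = g y"
  shows "frechet_derivative f (at p) = frechet_derivative g (at p)"
proof -
  have "(f has_derivative D) (at p) = (g has_derivative D) (at p)" for D
    using assms has_derivative_transform_within_open[of f D p UNIV U g]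
      has_derivative_transform_within_open[of g D p UNIV U f] by auto
  then show ?thesis by (simp add: frechet_derivative_def)
qed

lemma Ck_on_cong:
  assumes "open U"
  shows "Ck_on k U f \<Longrightarrow> (\<And>p. p \<in> U \<Longrightarrow> f p = g p) \<Longrightarrow> Ck_on k U g"
proof (induction k arbitrary: f g)
  case 0
  then show ?case using continuous_on_cong[of U U f g] by simp
next
  case (Suc k)
  have "f differentiable (at p) \<Longrightarrow> p \<in> U \<Longrightarrow> g differentiable (at p)" for p
    unfolding differentiable_def
    using has_derivative_transform_within_open[of f _ p UNIV U g] assms Suc.prems(2) by blast
  moreover have "Ck_on k U (\<lambda>p. frechet_derivative g (at p) v)" for v
    by (rule Suc.IH[of "\<lambda>p. frechet_derivative f (at p) v"])
      (use Suc.prems frechet_derivative_cong_open[OF assms, of _ f g] in auto)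
  ultimately show ?case using Suc.prems by auto
qed

text \<open>Uniqueness of the derivative allows any explicit candidate \<open>D\<close>, so later
  proofs need not unfold \<open>frechet_derivative\<close>.\<close>

lemma Ck_on_SucI:
  assumes "open U" and D: "\<And>p. p \<in> U \<Longrightarrow> (f has_derivative D p) (at p)"
    and C: "\<And>v. Ck_on k U (\<lambda>p. D p v)"
  shows "Ck_on (Suc k) U f"
proof -
  have "D p v = frechet_derivative f (at p) v" if "p \<in> U" for p v
    using frechet_derivative_at[OF D[OF that]] by simp
  then have "Ck_on k U (\<lambda>p. frechet_derivative f (at p) v)" for v
    by (intro Ck_on_cong[OF assms(1) C[of v]])
  then show ?thesis using D by (auto simp: differentiable_def)
qed

lemma Ck_on_Suc_has_derivative:
  assumes "Ck_on (Suc k) U f" "p \<in> U"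
  shows "(f has_derivative frechet_derivative f (at p)) (at p)"
  using assms frechet_derivative_works by auto

lemma Ck_on_SucD: "Ck_on (Suc k) U f \<Longrightarrow> Ck_on k U f"
proof (induction k arbitrary: f)
  case 0
  then show ?case
    by (auto intro!: continuous_at_imp_continuous_on differentiable_imp_continuous_within)
next
  case (Suc k)
  show ?case unfolding Ck_on.simps(2)[of k]
  proof (intro conjI allI)
    show "\<forall>p\<in>U. f differentiable at p" using Suc.prems by simp
    fix v
    have "Ck_on (Suc k) U (\<lambda>p. frechet_derivative f (at p) v)"
      using Suc.prems by (subst (asm) (1) Ck_on.simps) blast
    then show "Ck_on k U (\<lambda>p. frechet_derivative f (at p) v)" by (rule Suc.IH)
  qed
qed

lemma Ck_on_const: "open U \<Longrightarrow> Ck_on k U (\<lambda>p. c)"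
proof (induction k arbitrary: c)
  case (Suc k)
  show ?case
    by (rule Ck_on_SucI[OF Suc.prems, of _ "\<lambda>p v. 0"]) (use Suc in auto)
qed simp

lemma Ck_on_bounded_linear:
  assumes "open U" "bounded_linear L"
  shows "Ck_on k U L"
proof (cases k)
  case 0
  then show ?thesis using assms by (simp add: linear_continuous_on)
next
  case (Suc k')
  show ?thesis unfolding Suc
    by (rule Ck_on_SucI[OF assms(1), of _ "\<lambda>p. L"])
      (use assms in \<open>auto intro: bounded_linear_imp_has_derivative Ck_on_const\<close>)
qed

lemma Ck_on_add:
  assumes "open U"
  shows "Ck_on k U f \<Longrightarrow> Ck_on k U g \<Longrightarrow> Ck_on k U (\<lambda>p. f p + g p)"
proof (induction k arbitrary: f g)
  case (Suc k)
  show ?case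
    by (rule Ck_on_SucI[OF assms, of _
          "\<lambda>p v. frechet_derivative f (at p) v + frechet_derivative g (at p) v"])
      (use Suc assms in \<open>auto intro!: has_derivative_add simp: frechet_derivative_works[symmetric]\<close>)
qed (auto intro: continuous_on_add)

lemma Ck_on_scaleR:
  fixes f :: "'a::real_normed_vector \<Rightarrow> real"
  assumes "open U"
  shows "Ck_on k U f \<Longrightarrow> Ck_on k U g \<Longrightarrow> Ck_on k U (\<lambda>p. f p *\<^sub>R g p)"
proof (induction k arbitrary: f g)
  case (Suc k)
  have fg: "Ck_on k U f" "Ck_on k U g" using Suc.prems Ck_on_SucD by auto
  show ?case
    by (rule Ck_on_SucI[OF assms, of _
          "\<lambda>p v. f p *\<^sub>R frechet_derivative g (at p) v + frechet_derivative f (at p) v *\<^sub>R g p"])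
      (use Suc assms fg in \<open>auto intro!: has_derivative_scaleR Ck_on_add simp: frechet_derivative_works[symmetric]\<close>)
qed (auto intro: continuous_on_scaleR)

text \<open>With a real intermediate variable the outer derivative is determined by its value at 1,
  so the chain rule yields a \<open>scaleR\<close> product and the induction closes with
  \<open>Ck_on_scaleR\<close>.\<close>

lemma Ck_on_compose_real:
  fixes f :: "'a::real_normed_vector \<Rightarrow> real" and g :: "real \<Rightarrow> 'b::real_normed_vector"
  assumes "open U" "f ` U \<subseteq> J"
  shows "Ck_on k J g \<Longrightarrow> Ck_on k U f \<Longrightarrow> Ck_on k U (\<lambda>p. g (f p))"
proof (induction k arbitrary: g)
  case 0
  then show ?case using assms continuous_on_compose2 by auto
next
  case (Suc k)
  have f: "Ck_on k U f" using Suc.prems Ck_on_SucD by auto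
  show ?case
  proof (rule Ck_on_SucI[OF assms(1), of _
        "\<lambda>p v. frechet_derivative f (at p) v *\<^sub>R frechet_derivative g (at (f p)) 1"])
    fix p assume p: "p \<in> U"
    have g: "(g has_derivative frechet_derivative g (at (f p))) (at (f p))"
      by (rule Ck_on_Suc_has_derivative[OF Suc.prems(1)]) (use p assms(2) in blast)
    have eq: "frechet_derivative g (at (f p)) h = h *\<^sub>R frechet_derivative g (at (f p)) 1" for h
      using linear_scale[OF has_derivative_linear[OF g], of h 1] by simp
    show "((\<lambda>p. g (f p)) has_derivative
        (\<lambda>v. frechet_derivative f (at p) v *\<^sub>R frechet_derivative g (at (f p)) 1)) (at p)"
      using has_derivative_compose[OF Ck_on_Suc_has_derivative[OF Suc.prems(2) p] g]
      by (subst eq[symmetric])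
  next
    fix v
    have "Ck_on k U (\<lambda>p. frechet_derivative g (at (f p)) 1)"
      by (rule Suc.IH[OF _ f]) (use Suc.prems(1) in simp)
    moreover have "Ck_on k U (\<lambda>p. frechet_derivative f (at p) v)"
      using Suc.prems(2) by simp
    ultimately show "Ck_on k U (\<lambda>p. frechet_derivative f (at p) v *\<^sub>R frechet_derivative g (at (f p)) 1)"
      by (intro Ck_on_scaleR assms(1))
  qed
qed

lemma smooth_on_cong:
  assumes "open V" "smooth_on V f" "\<And>p. p \<in> V \<Longrightarrow> f p = g p"
  shows "smooth_on V g"
  using Ck_on_cong[OF assms(1)] assms(2,3) unfolding smooth_on_def by blast

lemma smooth_on_const: "open U \<Longrightarrow> smooth_on U (\<lambda>p. c)"
  by (simp add: smooth_on_def Ck_on_const)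

lemma smooth_on_add: "open U \<Longrightarrow> smooth_on U f \<Longrightarrow> smooth_on U g \<Longrightarrow> smooth_on U (\<lambda>p. f p + g p)"
  by (simp add: smooth_on_def Ck_on_add)

lemma smooth_on_scaleR:
  fixes f :: "'a::real_normed_vector \<Rightarrow> real"
  shows "open U \<Longrightarrow> smooth_on U f \<Longrightarrow> smooth_on U g \<Longrightarrow> smooth_on U (\<lambda>p. f p *\<^sub>R g p)"
  by (simp add: smooth_on_def Ck_on_scaleR)

lemma smooth_on_mult:
  fixes f :: "'a::real_normed_vector \<Rightarrow> real"
  shows "open U \<Longrightarrow> smooth_on U f \<Longrightarrow> smooth_on U g \<Longrightarrow> smooth_on U (\<lambda>p. f p * g p)"
  using smooth_on_scaleR[of U f g] by simp

lemma smooth_on_bounded_linear: "open U \<Longrightarrow> bounded_linear L \<Longrightarrow> smooth_on U L"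
  by (simp add: smooth_on_def Ck_on_bounded_linear)

lemma smooth_on_compose_real:
  fixes f :: "'a::real_normed_vector \<Rightarrow> real"
  shows "open U \<Longrightarrow> f ` U \<subseteq> J \<Longrightarrow> smooth_on J g \<Longrightarrow> smooth_on U f \<Longrightarrow> smooth_on U (\<lambda>p. g (f p))"
  by (simp add: smooth_on_def Ck_on_compose_real)

lemma smooth_on_has_derivative:
  "smooth_on U f \<Longrightarrow> p \<in> U \<Longrightarrow> (f has_derivative frechet_derivative f (at p)) (at p)"
  unfolding smooth_on_def using Ck_on_Suc_has_derivative by blast

lemma smooth_on_has_real_derivative:
  fixes g :: "real \<Rightarrow> real"
  assumes "smooth_on J g" "s \<in> J"
  shows "(g has_real_derivative deriv g s) (at s)"
  using smooth_on_has_derivative[OF assms]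
  by (metis DERIV_deriv_iff_real_differentiable differentiableI)

lemma smooth_on_deriv:
  fixes g :: "real \<Rightarrow> real"
  assumes "open J" "smooth_on J g"
  shows "smooth_on J (deriv g)"
  unfolding smooth_on_def
proof
  fix k
  have "Ck_on k J (\<lambda>s. frechet_derivative g (at s) 1)"
    using assms(2) unfolding smooth_on_def by (metis Ck_on.simps(2))
  moreover have "frechet_derivative g (at s) 1 = deriv g s" if "s \<in> J" for s
    using smooth_on_has_real_derivative[OF assms(2) that, THEN has_field_derivative_imp_has_derivative,
        THEN frechet_derivative_at] by (metis mult.right_neutral)
  ultimately show "Ck_on k J (deriv g)" using Ck_on_cong[OF assms(1)] by blast
qed

text \<open>A family closed under differentiation up to constant factors is smooth: the induction on
  \<open>k\<close> treats all its members at once. Powers and the trigonometric and hyperbolic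
  functions are instances.\<close>

lemma smooth_on_real_family:
  fixes g :: "'i \<Rightarrow> real \<Rightarrow> real"
  assumes "open J" and D: "\<And>i s. s \<in> J \<Longrightarrow> (g i has_real_derivative c i * g (\<sigma> i) s) (at s)"
  shows "smooth_on J (g i)"
  unfolding smooth_on_def
proof
  fix k
  show "Ck_on k J (g i)"
  proof (induction k arbitrary: i)
    case 0
    have "isCont (g i) s" if "s \<in> J" for s
      using DERIV_isCont[OF D[OF that]] .
    then show ?case by (simp add: continuous_at_imp_continuous_on)
  next
    case (Suc k)
    show ?case
    proof (rule Ck_on_SucI[OF assms(1)])
      fix s assume "s \<in> J"
      from has_field_derivative_imp_has_derivative[OF D[OF this, of i]]
      show "(g i has_derivative (\<lambda>v. (v * c i) *\<^sub>R g (\<sigma> i) s)) (at s)"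
        by (rule has_derivative_eq_rhs) (simp add: fun_eq_iff)
    next
      fix v
      show "Ck_on k J (\<lambda>s. (v * c i) *\<^sub>R g (\<sigma> i) s)"
        by (rule Ck_on_scaleR[OF assms(1) Ck_on_const[OF assms(1)] Suc.IH])
    qed
  qed
qed

lemma smooth_on_powr: "smooth_on {0<..} (\<lambda>y::real. y powr r)"
  by (rule smooth_on_real_family[where \<sigma> = "\<lambda>r. r - 1" and c = "\<lambda>r. r" and g = "\<lambda>r y. y powr r"])
    (auto intro!: derivative_eq_intros)

lemma smooth_on_cos: "smooth_on UNIV (\<lambda>t::real. cos (a * t))"
  and smooth_on_sin: "smooth_on UNIV (\<lambda>t::real. sin (a * t))"
proof -
  \<comment> \<open>The index \<open>True\<close> stands for the cosine and \<open>False\<close> for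
    the sine; differentiation swaps them through \<open>Not\<close>, with the sign only on the
    cosine.\<close>
  have "smooth_on UNIV (if i then (\<lambda>t::real. cos (a * t)) else (\<lambda>t. sin (a * t)))" for i
    by (rule smooth_on_real_family[where \<sigma> = Not and c = "\<lambda>i. if i then - a else a"
          and g = "\<lambda>i. if i then (\<lambda>t. cos (a * t)) else (\<lambda>t. sin (a * t))"])
      (auto intro!: derivative_eq_intros)
  from this[of True] this[of False]
  show "smooth_on UNIV (\<lambda>t::real. cos (a * t))" "smooth_on UNIV (\<lambda>t::real. sin (a * t))" by simp_all
qed

lemma smooth_on_cosh: "smooth_on UNIV (\<lambda>t::real. cosh (b * t))"
  and smooth_on_sinh: "smooth_on UNIV (\<lambda>t::real. sinh (b * t))"
proof -
  have "smooth_on UNIV (if i then (\<lambda>t::real. cosh (b * t)) else (\<lambda>t. sinh (b * t)))" for i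
    by (rule smooth_on_real_family[where \<sigma> = Not and c = "\<lambda>i. b"
          and g = "\<lambda>i. if i then (\<lambda>t. cosh (b * t)) else (\<lambda>t. sinh (b * t))"])
      (auto intro!: derivative_eq_intros)
  from this[of True] this[of False]
  show "smooth_on UNIV (\<lambda>t::real. cosh (b * t))" "smooth_on UNIV (\<lambda>t::real. sinh (b * t))" by simp_all
qed

lemma smooth_on_vector4:
  fixes f1 f2 f3 f4 :: "'a::real_normed_vector \<Rightarrow> real"
  assumes "open U" "smooth_on U f1" "smooth_on U f2" "smooth_on U f3" "smooth_on U f4"
  shows "smooth_on U (\<lambda>p. vector [f1 p, f2 p, f3 p, f4 p] :: real^4)"
proof -
  have "(\<lambda>p. vector [f1 p, f2 p, f3 p, f4 p] :: real^4) =
      (\<lambda>p. f1 p *\<^sub>R axis 1 1 + f2 p *\<^sub>R axis 2 1 + f3 p *\<^sub>R axis 3 1 + f4 p *\<^sub>R axis 4 1)"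
    by (simp add: vec_eq_iff forall_4 vector_def axis_def fun_eq_iff)
  moreover have "smooth_on U \<dots>"
    by (intro smooth_on_add smooth_on_scaleR smooth_on_const assms)
  ultimately show ?thesis by simp
qed

section \<open>Linear algebra of Minkowski space\<close>

lemma det_4:
  "det (A::'a::comm_ring_1^4^4) =
    A$1$1 * (A$2$2 * (A$3$3 * A$4$4 - A$3$4 * A$4$3) - A$2$3 * (A$3$2 * A$4$4 - A$3$4 * A$4$2)
      + A$2$4 * (A$3$2 * A$4$3 - A$3$3 * A$4$2))
  - A$1$2 * (A$2$1 * (A$3$3 * A$4$4 - A$3$4 * A$4$3) - A$2$3 * (A$3$1 * A$4$4 - A$3$4 * A$4$1)
      + A$2$4 * (A$3$1 * A$4$3 - A$3$3 * A$4$1))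
  + A$1$3 * (A$2$1 * (A$3$2 * A$4$4 - A$3$4 * A$4$2) - A$2$2 * (A$3$1 * A$4$4 - A$3$4 * A$4$1)
      + A$2$4 * (A$3$1 * A$4$2 - A$3$2 * A$4$1))
  - A$1$4 * (A$2$1 * (A$3$2 * A$4$3 - A$3$3 * A$4$2) - A$2$2 * (A$3$1 * A$4$3 - A$3$3 * A$4$1)
      + A$2$3 * (A$3$1 * A$4$2 - A$3$2 * A$4$1))"
proof -
  have f1: "finite {2::4, 3, 4}" "1 \<notin> {2::4, 3, 4}" by auto
  have f2: "finite {3::4, 4}" "2 \<notin> {3::4, 4}" by auto
  have f3: "finite {4::4}" "3 \<notin> {4::4}" by auto
  show ?thesis
    unfolding det_def UNIV_4
    unfolding sum_over_permutations_insert[OF f1]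
    unfolding sum_over_permutations_insert[OF f2]
    unfolding sum_over_permutations_insert[OF f3]
    unfolding permutes_sing
    by (simp add: sign_swap_id permutation_swap_id permutation_compose sign_compose sign_id
        swap_id_eq transpose_def algebra_simps)
qed

lemma vector_4 [simp]:
  "(vector [x, y, z, u] :: 'a::zero^4)$1 = x" "(vector [x, y, z, u] :: 'a::zero^4)$2 = y"
  "(vector [x, y, z, u] :: 'a::zero^4)$3 = z" "(vector [x, y, z, u] :: 'a::zero^4)$4 = u"
  by (simp_all add: vector_def)

lemma bounded_bilinear_lor: "bounded_bilinear lor"
  by (subst bilinear_conv_bounded_bilinear[symmetric])
    (auto simp: bilinear_def lor_def algebra_simps intro!: linearI)

lemma bounded_bilinear_wedge: "bounded_bilinear wedge"
  by (subst bilinear_conv_bounded_bilinear[symmetric])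
    (auto simp: bilinear_def wedge_def vec_eq_iff algebra_simps intro!: linearI)

text \<open>The induced inner product of the bivector \<open>C\<close> with the wedge of
  \<open>u\<close> and \<open>v\<close>, as \<open>contraction_wedge\<close> confirms. It reads off
  the components of \<open>C\<close> in a moving frame.\<close>

definition contraction :: "real^4^4 \<Rightarrow> real^4 \<Rightarrow> real^4 \<Rightarrow> real" where
  "contraction C u v = lor u (\<chi> i. lor (C$i) v)"

lemma bounded_bilinear_contraction: "bounded_bilinear (contraction C)"
  by (subst bilinear_conv_bounded_bilinear[symmetric])
    (auto simp: bilinear_def contraction_def lor_def algebra_simps intro!: linearI)

lemma contraction_add: "contraction (A + B) u v = contraction A u v + contraction B u v"
  and contraction_diff: "contraction (A - B) u v = contraction A u v - contraction B u v"
  and contraction_scaleR: "contraction (r *\<^sub>R A) u v = r * contraction A u v"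
  by (simp_all add: contraction_def lor_def algebra_simps)

lemma contraction_wedge: "contraction (wedge y z) u v = lor u y * lor v z - lor u z * lor v y"
  by (simp add: contraction_def lor_def wedge_def algebra_simps)

lemma contraction_swap:
  assumes "C \<in> bivectors"
  shows "contraction C u v = - contraction C v u"
proof -
  have s: "C$j$i = - (C$i$j)" for i j
  proof -
    have "transpose C $ i $ j = (- C) $ i $ j" using assms by (simp only: bivectors_def mem_Collect_eq)
    then show ?thesis by (simp add: transpose_def)
  qed
  show ?thesis
    using s[of 1 1] s[of 2 2] s[of 3 3] s[of 4 4]
    by (simp add: contraction_def lor_def s[of 1 2] s[of 1 3] s[of 1 4] s[of 2 3] s[of 2 4] s[of 3 4]
        algebra_simps)
qed

lemma contraction_self: "C \<in> bivectors \<Longrightarrow> contraction C u u = 0"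
  using contraction_swap[of C u u] by simp

lemma lor_commute: "lor u v = lor v u"
  by (simp add: lor_def mult.commute)

lemmas lor_simps = bounded_bilinear.add_left[OF bounded_bilinear_lor]
  bounded_bilinear.add_right[OF bounded_bilinear_lor]
  bounded_bilinear.diff_left[OF bounded_bilinear_lor]
  bounded_bilinear.diff_right[OF bounded_bilinear_lor]
  bounded_bilinear.scaleR_left[OF bounded_bilinear_lor]
  bounded_bilinear.scaleR_right[OF bounded_bilinear_lor]
  bounded_bilinear.zero_left[OF bounded_bilinear_lor]
  bounded_bilinear.zero_right[OF bounded_bilinear_lor]
  bounded_bilinear.minus_left[OF bounded_bilinear_lor]
  bounded_bilinear.minus_right[OF bounded_bilinear_lor]

lemmas contraction_simps = bounded_bilinear.add_left[OF bounded_bilinear_contraction]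
  bounded_bilinear.add_right[OF bounded_bilinear_contraction]
  bounded_bilinear.diff_left[OF bounded_bilinear_contraction]
  bounded_bilinear.diff_right[OF bounded_bilinear_contraction]
  bounded_bilinear.scaleR_left[OF bounded_bilinear_contraction]
  bounded_bilinear.scaleR_right[OF bounded_bilinear_contraction]

lemmas wedge_simps = bounded_bilinear.add_left[OF bounded_bilinear_wedge]
  bounded_bilinear.add_right[OF bounded_bilinear_wedge]
  bounded_bilinear.diff_left[OF bounded_bilinear_wedge]
  bounded_bilinear.diff_right[OF bounded_bilinear_wedge]
  bounded_bilinear.scaleR_left[OF bounded_bilinear_wedge]
  bounded_bilinear.scaleR_right[OF bounded_bilinear_wedge]

lemma wedge_self [simp]: "wedge u u = 0"
  by (simp add: wedge_def vec_eq_iff)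

lemma wedge_in_bivectors: "wedge u v \<in> bivectors"
  by (simp add: bivectors_def wedge_def transpose_def vec_eq_iff)

text \<open>Nondegeneracy of the metric: a vector orthogonal to a basis vanishes.\<close>

lemma lor_eq_0_imp_0:
  assumes "det (vector [g1, g2, g3, g4] :: real^4^4) \<noteq> 0"
    and "lor v g1 = 0" "lor v g2 = 0" "lor v g3 = 0" "lor v g4 = 0"
  shows "v = 0"
proof -
  let ?M = "vector [g1, g2, g3, g4] :: real^4^4"
  \<comment> \<open>Flipping the timelike coordinate turns the Lorentz products with the rows into
    an ordinary matrix-vector product.\<close>
  let ?v = "vector [v$1, v$2, v$3, - (v$4)] :: real^4"
  have "?M *v ?v = 0"
    using assms(2-) by (simp add: vec_eq_iff forall_4 matrix_vector_mult_def sum_4 lor_def mult.commute)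
  moreover have "\<exists>B. B ** ?M = mat 1"
    using assms(1) invertible_det_nz[of ?M] by (auto simp: invertible_def)
  ultimately have "?v = 0" by (simp add: matrix_left_invertible_ker)
  then show ?thesis by (simp add: vec_eq_iff forall_4)
qed

text \<open>Nondegeneracy is applied once for each of the two indices of \<open>C\<close>.\<close>

lemma contraction_eq_0_imp_0:
  assumes "det (vector [g1, g2, g3, g4] :: real^4^4) \<noteq> 0"
    and "\<And>u v. u \<in> {g1, g2, g3, g4} \<Longrightarrow> v \<in> {g1, g2, g3, g4} \<Longrightarrow> contraction C u v = 0"
  shows "C = 0"
proof -
  have z: "lor (C$i) v = 0" if v: "v \<in> {g1, g2, g3, g4}" for v i
  proof -
    have z: "lor (\<chi> i. lor (C$i) v) u = 0" if "u \<in> {g1, g2, g3, g4}" for u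
      unfolding lor_commute[of _ u] contraction_def[symmetric] by (rule assms(2)[OF that v])
    have "(\<chi> i. lor (C$i) v) = 0"
      by (rule lor_eq_0_imp_0[OF assms(1)]) (rule z; simp)+
    from arg_cong[OF this, of "\<lambda>y. y$i"] show ?thesis by simp
  qed
  have "C$i = 0" for i
    by (rule lor_eq_0_imp_0[OF assms(1)]) (rule z; simp)+
  then show ?thesis by (simp add: vec_eq_iff)
qed

section \<open>Partial derivatives of maps on the parameter plane\<close>

text \<open>Total differentiability is part of the notion, since \<open>push\<close> and
  \<open>along\<close> are defined by \<open>frechet_derivative\<close>; existence of the two
  partial derivatives alone would not determine it.\<close>

definition has_partials ::
  "(real \<times> real \<Rightarrow> 'a::real_normed_vector) \<Rightarrow> 'a \<Rightarrow> 'a \<Rightarrow> real \<times> real \<Rightarrow> bool" where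
  "has_partials F P Q p \<longleftrightarrow> (F has_derivative (\<lambda>h. fst h *\<^sub>R P + snd h *\<^sub>R Q)) (at p)"

lemma has_partials_frechet_derivative:
  "has_partials F P Q p \<Longrightarrow> frechet_derivative F (at p) h = fst h *\<^sub>R P + snd h *\<^sub>R Q"
  unfolding has_partials_def by (drule frechet_derivative_at[THEN sym]) simp

lemma has_partials_along:
  "has_partials F P Q p \<Longrightarrow> along X F p = fst (X p) *\<^sub>R P + snd (X p) *\<^sub>R Q"
  by (simp add: along_def has_partials_frechet_derivative)

lemma has_partials_cong:
  "has_partials F P Q p \<Longrightarrow> P = P' \<Longrightarrow> Q = Q' \<Longrightarrow> has_partials F P' Q' p"
  by simp

lemma has_partials_transform:
  assumes "has_partials F P Q p" "open U" "p \<in> U" "\<And>y. y \<in> U \<Longrightarrow> F y = G y"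
  shows "has_partials G P Q p"
  using assms has_derivative_transform_within_open[of F _ p UNIV U G]
  unfolding has_partials_def by blast

lemma has_partials_unique:
  assumes "has_partials F P Q p" "has_partials F P' Q' p"
  shows "P = P'" "Q = Q'"
  using has_partials_frechet_derivative[OF assms(1), of "(1,0)"] has_partials_frechet_derivative[OF assms(2), of "(1,0)"]
    has_partials_frechet_derivative[OF assms(1), of "(0,1)"] has_partials_frechet_derivative[OF assms(2), of "(0,1)"]
  by auto

lemma has_partials_const: "has_partials (\<lambda>p. k) 0 0 p"
  by (simp add: has_partials_def)

lemma has_partials_add:
  assumes "has_partials F P Q p" "has_partials G P' Q' p"
  shows "has_partials (\<lambda>y. F y + G y) (P + P') (Q + Q') p"
  using has_derivative_add[OF assms[unfolded has_partials_def]]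
  by (simp add: has_partials_def algebra_simps)

lemma has_partials_bilinear:
  assumes "bounded_bilinear m" "has_partials F P Q p" "has_partials G P' Q' p"
  shows "has_partials (\<lambda>y. m (F y) (G y)) (m (F p) P' + m P (G p)) (m (F p) Q' + m Q (G p)) p"
proof -
  interpret m: bounded_bilinear m by fact
  show ?thesis
    using m.FDERIV[OF assms(2,3)[unfolded has_partials_def]]
    by (simp add: has_partials_def m.add_left m.add_right m.scaleR_left m.scaleR_right algebra_simps)
qed

lemmas has_partials_wedge = has_partials_bilinear[OF bounded_bilinear_wedge]
lemmas has_partials_contraction = has_partials_bilinear[OF bounded_bilinear_contraction]
lemmas has_partials_scaleR = has_partials_bilinear[OF bounded_bilinear_scaleR]
lemmas has_partials_mult = has_partials_bilinear[OF bounded_bilinear_mult]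

lemma has_partials_fst:
  fixes g :: "real \<Rightarrow> real"
  assumes "(g has_real_derivative d) (at (fst p))"
  shows "has_partials (\<lambda>y. g (fst y)) d 0 p"
  unfolding has_partials_def
  by (rule has_derivative_eq_rhs[OF has_derivative_compose[OF has_derivative_fst[OF has_derivative_ident]
        has_field_derivative_imp_has_derivative[OF assms]]]) (simp add: fun_eq_iff)

lemma has_partials_snd:
  fixes g :: "real \<Rightarrow> real"
  assumes "(g has_real_derivative d) (at (snd p))"
  shows "has_partials (\<lambda>y. g (snd y)) 0 d p"
  unfolding has_partials_def
  by (rule has_derivative_eq_rhs[OF has_derivative_compose[OF has_derivative_snd[OF has_derivative_ident]
        has_field_derivative_imp_has_derivative[OF assms]]]) (simp add: fun_eq_iff)

lemma has_partials_vector4: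
  fixes f1 f2 f3 f4 :: "real \<times> real \<Rightarrow> real"
  assumes "has_partials f1 P1 Q1 p" "has_partials f2 P2 Q2 p" "has_partials f3 P3 Q3 p" "has_partials f4 P4 Q4 p"
  shows "has_partials (\<lambda>y. vector [f1 y, f2 y, f3 y, f4 y] :: real^4)
    (vector [P1, P2, P3, P4]) (vector [Q1, Q2, Q3, Q4]) p"
proof -
  have v: "(vector [z1, z2, z3, z4] :: real^4) =
      z1 *\<^sub>R axis 1 1 + z2 *\<^sub>R axis 2 1 + z3 *\<^sub>R axis 3 1 + z4 *\<^sub>R axis 4 1" for z1 z2 z3 z4
    by (simp add: vec_eq_iff forall_4 axis_def)
  show ?thesis
    unfolding v
    by (rule has_partials_cong[OF has_partials_add[OF has_partials_add[OF has_partials_add[OF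
          has_partials_scaleR[OF assms(1) has_partials_const] has_partials_scaleR[OF assms(2) has_partials_const]]
          has_partials_scaleR[OF assms(3) has_partials_const]] has_partials_scaleR[OF assms(4) has_partials_const]]])
      simp_all
qed

section \<open>Vectors in a double rotating frame\<close>

text \<open>The vector with constants \<open>c1, ..., c4\<close> carried along by the one-parameter
  group that rotates the first two coordinates by \<open>a t\<close> and boosts the last two by
  \<open>b t\<close>. These are isometries of determinant 1, so products and determinants do not
  depend on \<open>t\<close>.\<close>

definition moving :: "real \<Rightarrow> real \<Rightarrow> real \<Rightarrow> real \<Rightarrow> real \<Rightarrow> real \<Rightarrow> real \<Rightarrow> real^4" where
  "moving a b c1 c2 c3 c4 t = vector [c1 * cos (a * t) - c2 * sin (a * t), c1 * sin (a * t) + c2 * cos (a * t),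
     c3 * cosh (b * t) + c4 * sinh (b * t), c3 * sinh (b * t) + c4 * cosh (b * t)]"

lemma double_rot_moving: "double_rot a b x w p = moving a b (x (fst p)) 0 0 (w (fst p)) (snd p)"
  by (simp add: double_rot_def moving_def case_prod_beta)

lemma moving_scaleR: "r *\<^sub>R moving a b c1 c2 c3 c4 t = moving a b (r * c1) (r * c2) (r * c3) (r * c4) t"
  and moving_add: "moving a b c1 c2 c3 c4 t + moving a b d1 d2 d3 d4 t
    = moving a b (c1 + d1) (c2 + d2) (c3 + d3) (c4 + d4) t"
  and moving_diff: "moving a b c1 c2 c3 c4 t - moving a b d1 d2 d3 d4 t
    = moving a b (c1 - d1) (c2 - d2) (c3 - d3) (c4 - d4) t"
  by (simp_all add: moving_def vec_eq_iff forall_4 algebra_simps)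

lemma lor_moving:
  "lor (moving a b c1 c2 c3 c4 t) (moving a b d1 d2 d3 d4 t) = c1 * d1 + c2 * d2 + c3 * d3 - c4 * d4"
proof -
  have "sin (a * t) ^ 2 = 1 - cos (a * t) ^ 2" "cosh (b * t) ^ 2 = 1 + sinh (b * t) ^ 2"
    by (simp_all add: sin_squared_eq cosh_square_eq)
  then show ?thesis unfolding lor_def moving_def vector_4 by algebra
qed

lemma moving_cong:
  "c1 = d1 \<Longrightarrow> c2 = d2 \<Longrightarrow> c3 = d3 \<Longrightarrow> c4 = d4 \<Longrightarrow> moving a b c1 c2 c3 c4 t = moving a b d1 d2 d3 d4 t"
  by simp

text \<open>Moving all rows is multiplication from the right by \<open>?T\<close>, a rotation block
  and a boost block of determinant 1 each.\<close>

lemma det_moving: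
  "det (vector [moving a b c11 c12 c13 c14 t, moving a b c21 c22 c23 c24 t,
     moving a b c31 c32 c33 c34 t, moving a b c41 c42 c43 c44 t] :: real^4^4) =
   det (vector [vector [c11, c12, c13, c14], vector [c21, c22, c23, c24],
     vector [c31, c32, c33, c34], vector [c41, c42, c43, c44]] :: real^4^4)" (is "det ?L = det ?R")
proof -
  let ?T = "vector [vector [cos (a * t), sin (a * t), 0, 0], vector [- sin (a * t), cos (a * t), 0, 0],
     vector [0, 0, cosh (b * t), sinh (b * t)], vector [0, 0, sinh (b * t), cosh (b * t)]] :: real^4^4"
  have "cos (a * t) * cos (a * t) + sin (a * t) * sin (a * t) = 1"
    "cosh (b * t) * cosh (b * t) - sinh (b * t) * sinh (b * t) = 1"
    using sin_cos_squared_add2[of "a * t"] hyperbolic_pythagoras[of "b * t"] by (simp_all add: power2_eq_square)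
  then have "det ?T = 1" unfolding det_4 vector_4 by algebra
  moreover have "?L = ?R ** ?T"
    by (simp add: vec_eq_iff forall_4 matrix_matrix_mult_def sum_4 moving_def algebra_simps)
  ultimately show ?thesis by (simp add: det_mul)
qed

text \<open>Differentiating in \<open>t\<close> applies the generator of the group to the constants,
  so every derivative of a moving vector is again a moving vector.\<close>

lemma has_partials_moving:
  assumes "(c1 has_real_derivative d1) (at (fst p))" "(c2 has_real_derivative d2) (at (fst p))"
    "(c3 has_real_derivative d3) (at (fst p))" "(c4 has_real_derivative d4) (at (fst p))"
  shows "has_partials (\<lambda>y. moving a b (c1 (fst y)) (c2 (fst y)) (c3 (fst y)) (c4 (fst y)) (snd y))
    (moving a b d1 d2 d3 d4 (snd p))
    (moving a b (- a * c2 (fst p)) (a * c1 (fst p)) (b * c4 (fst p)) (b * c3 (fst p)) (snd p)) p"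
proof -
  have trig: "has_partials (\<lambda>y. cos (a * snd y)) 0 (- a * sin (a * snd p)) p"
    "has_partials (\<lambda>y. sin (a * snd y)) 0 (a * cos (a * snd p)) p"
    "has_partials (\<lambda>y. - sin (a * snd y)) 0 (- a * cos (a * snd p)) p"
    "has_partials (\<lambda>y. cosh (b * snd y)) 0 (b * sinh (b * snd p)) p"
    "has_partials (\<lambda>y. sinh (b * snd y)) 0 (b * cosh (b * snd p)) p"
    by (rule has_partials_snd; auto intro!: derivative_eq_intros)+
  note c = assms[THEN has_partials_fst]
  have *: "has_partials (\<lambda>y. vector [c1 (fst y) * cos (a * snd y) + c2 (fst y) * (- sin (a * snd y)),
      c1 (fst y) * sin (a * snd y) + c2 (fst y) * cos (a * snd y),
      c3 (fst y) * cosh (b * snd y) + c4 (fst y) * sinh (b * snd y),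
      c3 (fst y) * sinh (b * snd y) + c4 (fst y) * cosh (b * snd y)] :: real^4)
    (moving a b d1 d2 d3 d4 (snd p))
    (moving a b (- a * c2 (fst p)) (a * c1 (fst p)) (b * c4 (fst p)) (b * c3 (fst p)) (snd p)) p"
    unfolding moving_def
    by (rule has_partials_cong[OF has_partials_vector4[OF
          has_partials_add[OF has_partials_mult[OF c(1) trig(1)] has_partials_mult[OF c(2) trig(3)]]
          has_partials_add[OF has_partials_mult[OF c(1) trig(2)] has_partials_mult[OF c(2) trig(1)]]
          has_partials_add[OF has_partials_mult[OF c(3) trig(4)] has_partials_mult[OF c(4) trig(5)]]
          has_partials_add[OF has_partials_mult[OF c(3) trig(5)] has_partials_mult[OF c(4) trig(4)]]]])
      (simp_all add: vec_eq_iff forall_4 algebra_simps)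
  then show ?thesis by (simp add: moving_def)
qed

lemma smooth_on_moving:
  fixes I :: "real set"
  assumes "open I" "smooth_on I c1" "smooth_on I c2" "smooth_on I c3" "smooth_on I c4" "V \<subseteq> I \<times> UNIV" "open V"
  shows "smooth_on V (\<lambda>y. moving a b (c1 (fst y)) (c2 (fst y)) (c3 (fst y)) (c4 (fst y)) (snd y))"
proof -
  have fst: "smooth_on V (\<lambda>y. c (fst y))" if "smooth_on I c" for c :: "real \<Rightarrow> real"
    by (rule smooth_on_compose_real[OF assms(7) _ that])
      (use assms(6) in \<open>auto intro: smooth_on_bounded_linear[OF assms(7) bounded_linear_fst]\<close>)
  have snd: "smooth_on V (\<lambda>y. c (snd y))" if "smooth_on UNIV c" for c :: "real \<Rightarrow> real"
    by (rule smooth_on_compose_real[OF assms(7) _ that])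
      (auto intro: smooth_on_bounded_linear[OF assms(7) bounded_linear_snd])
  note c = assms(2-5)[THEN fst] and trig = smooth_on_cos[of a, THEN snd] smooth_on_sin[of a, THEN snd]
    smooth_on_cosh[of b, THEN snd] smooth_on_sinh[of b, THEN snd]
  have "smooth_on V (\<lambda>y. vector [c1 (fst y) * cos (a * snd y) + (- 1) * (c2 (fst y) * sin (a * snd y)),
      c1 (fst y) * sin (a * snd y) + c2 (fst y) * cos (a * snd y),
      c3 (fst y) * cosh (b * snd y) + c4 (fst y) * sinh (b * snd y),
      c3 (fst y) * sinh (b * snd y) + c4 (fst y) * cosh (b * snd y)] :: real^4)"
    by (intro smooth_on_vector4 smooth_on_add smooth_on_mult smooth_on_const assms(7) c trig)
  then show ?thesis by (simp add: moving_def)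
qed

section \<open>Double rotational surfaces\<close>

text \<open>The assumption \<open>immersed\<close> says that the \<open>t\<close>-derivative of the
  surface does not vanish; \<open>timelike_double_rot_imp_immersed\<close> extracts it from
  timelikeness.\<close>

locale double_rotational_surface =
  fixes a b :: real and x w :: "real \<Rightarrow> real" and I :: "real set"
  assumes open_I: "open I" and interval_I: "is_interval I"
    and smooth_x: "smooth_on I x" and smooth_w: "smooth_on I w"
    and arc_length: "s \<in> I \<Longrightarrow> (deriv w s)\<^sup>2 - (deriv x s)\<^sup>2 = 1"
    and a_nonzero: "a \<noteq> 0" and b_nonzero: "b \<noteq> 0"
    and immersed: "s \<in> I \<Longrightarrow> (a * x s)\<^sup>2 + (b * w s)\<^sup>2 > 0"
begin

abbreviation "U \<equiv> I \<times> {0<..<2*pi}"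
abbreviation "r \<equiv> double_rot a b x w"
abbreviation "x1 \<equiv> deriv x"
abbreviation "w1 \<equiv> deriv w"

text \<open>The \<open>t\<close>-derivative of \<open>r\<close> is the moving vector with constants
  \<open>(0, a x, b w, 0)\<close>. It is spacelike of length \<open>q\<close>, and
  \<open>(m, n)\<close> is its direction.\<close>

definition "q s = sqrt ((a * x s)\<^sup>2 + (b * w s)\<^sup>2)"
definition "m s = a * x s / q s"
definition "n s = b * w s / q s"
text \<open>With \<open>h\<close> the second fundamental form: \<open>h(e1,e1) = c e3\<close>,
  \<open>h(e1,e2) = \<mu> e4\<close>, \<open>h(e2,e2) = \<beta> e3\<close>. The tangential part of
  the derivative of \<open>e1\<close> along \<open>e2\<close> is \<open>\<rho> e2\<close>, and the
  normal part of that of \<open>e3\<close> is \<open>\<kappa> e4\<close>.\<close>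

definition "c s = deriv x1 s * w1 s - deriv w1 s * x1 s"
definition "\<rho> s = (a * m s * x1 s + b * n s * w1 s) / q s"
definition "\<mu> s = (b * m s * w1 s - a * n s * x1 s) / q s"
definition "\<beta> s = - (a * m s * w1 s + b * n s * x1 s) / q s"
definition "\<kappa> s = (b * m s * x1 s - a * n s * w1 s) / q s"

text \<open>\<open>e1\<close> is tangent to the profile, and exchanging its two entries gives its
  Lorentz-orthogonal partner \<open>e3\<close>. The other two directions span a spacelike plane, so
  a quarter turn takes \<open>e2\<close> to \<open>e4\<close>.\<close>

definition "e1 y = moving a b (x1 (fst y)) 0 0 (w1 (fst y)) (snd y)"
definition "e2 y = moving a b 0 (m (fst y)) (n (fst y)) 0 (snd y)"
definition "e3 y = moving a b (w1 (fst y)) 0 0 (x1 (fst y)) (snd y)"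
definition "e4 y = moving a b 0 (- n (fst y)) (m (fst y)) 0 (snd y)"

definition E1 :: "real \<times> real \<Rightarrow> real \<times> real" where "E1 y = (1, 0)"
definition E2 :: "real \<times> real \<Rightarrow> real \<times> real" where "E2 y = (0, 1 / q (fst y))"

lemma open_U: "open U" using open_I by (simp add: open_Times)

lemma q_pos: "s \<in> I \<Longrightarrow> q s > 0"
  using immersed by (simp add: q_def)

lemma q_nonzero: "s \<in> I \<Longrightarrow> q s \<noteq> 0"
  using q_pos by force

lemma q_square: "(q s)\<^sup>2 = (a * x s)\<^sup>2 + (b * w s)\<^sup>2"
  by (simp add: q_def)

lemma unit_mn: assumes "s \<in> I" shows "(m s)\<^sup>2 + (n s)\<^sup>2 = 1"
proof -
  have "(m s)\<^sup>2 + (n s)\<^sup>2 = ((a * x s)\<^sup>2 + (b * w s)\<^sup>2) / (q s)\<^sup>2"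
    by (simp add: m_def n_def power_divide add_divide_distrib)
  then show ?thesis using q_nonzero[OF assms] unfolding q_square[symmetric] by simp
qed

text \<open>The definitions with denominators cleared, as polynomial identities that
  \<open>algebra\<close> can use.\<close>

lemma q_mult:
  assumes "s \<in> I"
  shows "q s * m s = a * x s" "q s * n s = b * w s"
    "q s * \<rho> s = a * m s * x1 s + b * n s * w1 s"
    "q s * \<mu> s = b * m s * w1 s - a * n s * x1 s"
    "q s * \<beta> s = - (a * m s * w1 s + b * n s * x1 s)"
    "q s * \<kappa> s = b * m s * x1 s - a * n s * w1 s"
  using q_nonzero[OF assms] by (simp_all add: m_def n_def \<rho>_def \<mu>_def \<beta>_def \<kappa>_def)

section \<open>Smoothness of the adapted frame\<close>

lemma smooth_profile: "smooth_on I x1" "smooth_on I w1"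
  by (rule smooth_on_deriv[OF open_I smooth_x] smooth_on_deriv[OF open_I smooth_w])+

lemma smooth_inverse_q: "smooth_on I (\<lambda>s. 1 / q s)"
proof -
  let ?Q = "\<lambda>s. (a * x s) * (a * x s) + (b * w s) * (b * w s)"
  have pos: "?Q s > 0" if "s \<in> I" for s
    using immersed[OF that] by (simp only: power2_eq_square)
  \<comment> \<open>Writing \<open>1 / q\<close> as a power brings it under
    \<open>smooth_on_powr\<close>.\<close>
  have half: "y powr (- (1/2)) = 1 / sqrt y" if "0 < y" for y :: real
    using that by (simp add: powr_minus powr_half_sqrt inverse_eq_divide)
  have "smooth_on I ?Q"
    by (intro smooth_on_add smooth_on_mult smooth_on_const open_I smooth_x smooth_w)
  then have "smooth_on I (\<lambda>s. ?Q s powr (- (1/2)))"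
    by (rule smooth_on_compose_real[OF open_I _ smooth_on_powr, where f = ?Q, rotated]) (use pos in blast)
  moreover have "?Q s powr (- (1/2)) = 1 / q s" if "s \<in> I" for s
    unfolding q_def power2_eq_square by (rule half[OF pos[OF that]])
  ultimately show ?thesis by (rule smooth_on_cong[OF open_I])
qed

lemma smooth_mn: "smooth_on I m" "smooth_on I n" "smooth_on I (\<lambda>s. - n s)"
proof -
  have "smooth_on I (\<lambda>s. a * x s * (1 / q s))" "smooth_on I (\<lambda>s. b * w s * (1 / q s))"
    "smooth_on I (\<lambda>s. (- 1) * (b * w s * (1 / q s)))"
    by (intro smooth_on_mult smooth_on_const open_I smooth_x smooth_w smooth_inverse_q)+
  then show "smooth_on I m" "smooth_on I n" "smooth_on I (\<lambda>s. - n s)"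
    by (simp_all add: m_def[abs_def] n_def[abs_def])
qed

lemma smooth_frame: "smooth_on U e1" "smooth_on U e2" "smooth_on U e3" "smooth_on U e4"
proof -
  have "U \<subseteq> I \<times> UNIV" by auto
  note sm = smooth_on_moving[OF open_I _ _ _ _ this open_U]
  show "smooth_on U e1" "smooth_on U e2" "smooth_on U e3" "smooth_on U e4"
    unfolding e1_def[abs_def] e2_def[abs_def] e3_def[abs_def] e4_def[abs_def]
    by (rule sm; rule smooth_profile smooth_mn smooth_on_const[OF open_I])+
qed

lemma smooth_E: "smooth_on U E1" "smooth_on U E2"
proof -
  show "smooth_on U E1" unfolding E1_def[abs_def] by (rule smooth_on_const[OF open_U])
  have "smooth_on U (\<lambda>y. 1 / q (fst y))"
    by (rule smooth_on_compose_real[OF open_U _ smooth_inverse_q])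
      (auto intro: smooth_on_bounded_linear[OF open_U bounded_linear_fst])
  then have "smooth_on U (\<lambda>y. (1 / q (fst y)) *\<^sub>R (0, 1 :: real))"
    by (intro smooth_on_scaleR smooth_on_const open_U)
  then show "smooth_on U E2" by (simp add: E2_def[abs_def] zero_prod_def)
qed

section \<open>Structure equations and integrability conditions\<close>

lemma deriv_profile:
  assumes "s \<in> I"
  shows "(x has_real_derivative x1 s) (at s)" "(w has_real_derivative w1 s) (at s)"
    "(x1 has_real_derivative c s * w1 s) (at s)" "(w1 has_real_derivative c s * x1 s) (at s)"
    "(c has_real_derivative deriv c s) (at s)"
proof -
  show "(x has_real_derivative x1 s) (at s)" "(w has_real_derivative w1 s) (at s)"
    using smooth_on_has_real_derivative smooth_x smooth_w assms by auto
  have d: "(x1 has_real_derivative deriv x1 s) (at s)" "(w1 has_real_derivative deriv w1 s) (at s)"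
    using smooth_on_has_real_derivative smooth_profile assms by auto
  \<comment> \<open>Differentiating the arc length condition shows that the acceleration of the
    profile is a multiple of \<open>(w1, x1)\<close>; the factor is \<open>c\<close>.\<close>
  have "((\<lambda>s. (w1 s)\<^sup>2 - (x1 s)\<^sup>2) has_real_derivative 2 * w1 s * deriv w1 s - 2 * x1 s * deriv x1 s) (at s)"
    by (auto intro!: derivative_eq_intros d)
  moreover have "((\<lambda>s. (w1 s)\<^sup>2 - (x1 s)\<^sup>2) has_real_derivative 0) (at s)"
    by (rule has_field_derivative_transform_within_open[OF DERIV_const[of 1] open_I assms])
      (simp add: arc_length)
  ultimately have "2 * w1 s * deriv w1 s - 2 * x1 s * deriv x1 s = 0" by (rule DERIV_unique)
  then have o: "w1 s * deriv w1 s = x1 s * deriv x1 s" by simp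
  note l = arc_length[OF assms]
  have "c s * w1 s = deriv x1 s" "c s * x1 s = deriv w1 s"
    unfolding c_def using o l by algebra+
  with d show "(x1 has_real_derivative c s * w1 s) (at s)" "(w1 has_real_derivative c s * x1 s) (at s)"
    by simp_all
  have "smooth_on I (\<lambda>s. deriv x1 s * w1 s + (- 1) * (deriv w1 s * x1 s))"
    by (intro smooth_on_add smooth_on_mult smooth_on_const smooth_on_deriv smooth_profile open_I)
  then have "smooth_on I c" by (simp add: c_def[abs_def])
  then show "(c has_real_derivative deriv c s) (at s)"
    using smooth_on_has_real_derivative assms by blast
qed

lemma deriv_q: assumes "s \<in> I" shows "(q has_real_derivative q s * \<rho> s) (at s)"
proof -
  have "((\<lambda>s. sqrt ((a * x s)\<^sup>2 + (b * w s)\<^sup>2)) has_real_derivative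
      (2 * (a * x s) * (a * x1 s) + 2 * (b * w s) * (b * w1 s)) * (inverse (q s) / 2)) (at s)"
    using immersed[OF assms] unfolding q_def
    by (auto intro!: derivative_eq_intros deriv_profile[OF assms] simp: field_simps power2_eq_square)
  moreover have "(2 * (a * x s) * (a * x1 s) + 2 * (b * w s) * (b * w1 s)) * (inverse (q s) / 2) = q s * \<rho> s"
    using q_nonzero[OF assms] unfolding q_mult[OF assms] m_def n_def by (simp add: field_simps)
  ultimately show ?thesis unfolding q_def[abs_def] by simp
qed

text \<open>A unit vector in a Euclidean plane can only rotate, so its derivative is a multiple of
  \<open>(- n, m)\<close>. The angular speed is the same \<mu> that occurs in the second fundamental
  form.\<close>

lemma deriv_mn:
  assumes "s \<in> I"
  shows "(m has_real_derivative - \<mu> s * n s) (at s)" "(n has_real_derivative \<mu> s * m s) (at s)"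
    "((\<lambda>s. - n s) has_real_derivative - \<mu> s * m s) (at s)"
proof -
  note qn = q_nonzero[OF assms]
  have "((\<lambda>s. a * x s / q s) has_real_derivative (a * x1 s * q s - a * x s * (q s * \<rho> s)) / (q s * q s)) (at s)"
    "((\<lambda>s. b * w s / q s) has_real_derivative (b * w1 s * q s - b * w s * (q s * \<rho> s)) / (q s * q s)) (at s)"
    using qn by (auto intro!: derivative_eq_intros deriv_profile[OF assms] deriv_q[OF assms])
  moreover have "a * x1 s * q s - a * x s * (q s * \<rho> s) = (- \<mu> s * n s) * (q s * q s)"
    "b * w1 s * q s - b * w s * (q s * \<rho> s) = \<mu> s * m s * (q s * q s)"
    using q_mult[OF assms] unit_mn[OF assms] by algebra+
  ultimately show "(m has_real_derivative - \<mu> s * n s) (at s)" and *: "(n has_real_derivative \<mu> s * m s) (at s)"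
    unfolding m_def[abs_def] n_def[abs_def] using qn by (simp_all add: m_def n_def)
  show "((\<lambda>s. - n s) has_real_derivative - \<mu> s * m s) (at s)"
    using DERIV_minus[OF *] by simp
qed

text \<open>The first two are the Codazzi equations, the third is the Ricci equation. The factor
  \<open>q\<close> in the third appears because the coordinate field in direction \<open>t\<close>
  is \<open>q e2\<close>.\<close>

lemma deriv_forms:
  assumes "s \<in> I"
  shows "(\<mu> has_real_derivative c s * \<kappa> s - 2 * \<rho> s * \<mu> s) (at s)"
    "(\<beta> has_real_derivative - \<rho> s * (c s + \<beta> s) - \<mu> s * \<kappa> s) (at s)"
    "((\<lambda>s. q s * \<kappa> s) has_real_derivative q s * (\<mu> s * (c s + \<beta> s))) (at s)"
proof -
  note qn = q_nonzero[OF assms]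
  note d = deriv_profile[OF assms] deriv_q[OF assms] deriv_mn[OF assms]
  let ?M = "\<lambda>s. b * m s * w1 s - a * n s * x1 s" and ?B = "\<lambda>s. - (a * m s * w1 s + b * n s * x1 s)"
    and ?K = "\<lambda>s. b * m s * x1 s - a * n s * w1 s"
  have M: "(?M has_real_derivative q s * (c s * \<kappa> s - \<rho> s * \<mu> s)) (at s)"
    by (rule derivative_eq_intros d refl)+ (use q_mult[OF assms] in algebra)
  have B: "(?B has_real_derivative q s * (- c s * \<rho> s - \<mu> s * \<kappa> s)) (at s)"
    by (rule derivative_eq_intros d refl)+ (use q_mult[OF assms] in algebra)
  have K: "(?K has_real_derivative q s * (\<mu> s * (c s + \<beta> s))) (at s)"
    by (rule derivative_eq_intros d refl)+ (use q_mult[OF assms] in algebra)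
  have "((\<lambda>s. ?M s / q s) has_real_derivative
      (q s * (c s * \<kappa> s - \<rho> s * \<mu> s) * q s - ?M s * (q s * \<rho> s)) / (q s * q s)) (at s)"
    by (rule DERIV_divide[OF M d(6) qn])
  moreover have "q s * (c s * \<kappa> s - \<rho> s * \<mu> s) * q s - ?M s * (q s * \<rho> s)
      = (c s * \<kappa> s - 2 * \<rho> s * \<mu> s) * (q s * q s)"
    using q_mult[OF assms] by algebra
  ultimately show "(\<mu> has_real_derivative c s * \<kappa> s - 2 * \<rho> s * \<mu> s) (at s)"
    unfolding \<mu>_def[abs_def] using qn by (simp add: \<mu>_def)
  have "((\<lambda>s. ?B s / q s) has_real_derivative
      (q s * (- c s * \<rho> s - \<mu> s * \<kappa> s) * q s - ?B s * (q s * \<rho> s)) / (q s * q s)) (at s)"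
    by (rule DERIV_divide[OF B d(6) qn])
  moreover have "q s * (- c s * \<rho> s - \<mu> s * \<kappa> s) * q s - ?B s * (q s * \<rho> s)
      = (- \<rho> s * (c s + \<beta> s) - \<mu> s * \<kappa> s) * (q s * q s)"
    using q_mult[OF assms] by algebra
  ultimately show "(\<beta> has_real_derivative - \<rho> s * (c s + \<beta> s) - \<mu> s * \<kappa> s) (at s)"
    unfolding \<beta>_def[abs_def] using qn by (simp add: \<beta>_def)
  show "((\<lambda>s. q s * \<kappa> s) has_real_derivative q s * (\<mu> s * (c s + \<beta> s))) (at s)"
    by (rule has_field_derivative_transform_within_open[OF K open_I assms]) (simp add: q_mult)
qed

lemma partials_r: assumes "p \<in> U" shows "has_partials r (e1 p) (q (fst p) *\<^sub>R e2 p) p"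
proof -
  have s: "fst p \<in> I" using assms by auto
  show ?thesis
    unfolding double_rot_moving[abs_def]
    by (rule has_partials_cong[OF has_partials_moving[OF deriv_profile(1)[OF s] DERIV_const DERIV_const deriv_profile(2)[OF s]]])
      (simp_all add: e1_def e2_def moving_scaleR q_mult[OF s])
qed

text \<open>The coefficient matrix is skew for \<open>lor\<close>: paired entries agree in sign when
  the timelike \<open>e1\<close> is involved and are opposite otherwise.\<close>

lemma partials_frame:
  assumes "p \<in> U"
  defines "s \<equiv> fst p"
  shows "has_partials e1 (c s *\<^sub>R e3 p) (q s *\<^sub>R (\<rho> s *\<^sub>R e2 p + \<mu> s *\<^sub>R e4 p)) p"
    "has_partials e2 (\<mu> s *\<^sub>R e4 p) (q s *\<^sub>R (\<rho> s *\<^sub>R e1 p + \<beta> s *\<^sub>R e3 p)) p"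
    "has_partials e3 (c s *\<^sub>R e1 p) (q s *\<^sub>R (\<kappa> s *\<^sub>R e4 p - \<beta> s *\<^sub>R e2 p)) p"
    "has_partials e4 (- \<mu> s *\<^sub>R e2 p) (q s *\<^sub>R (\<mu> s *\<^sub>R e1 p - \<kappa> s *\<^sub>R e3 p)) p"
proof -
  have s: "fst p \<in> I" using assms by auto
  note d = deriv_profile[OF s] deriv_mn[OF s]
    and alg = q_mult[OF s] unit_mn[OF s] arc_length[OF s]
  show "has_partials e1 (c s *\<^sub>R e3 p) (q s *\<^sub>R (\<rho> s *\<^sub>R e2 p + \<mu> s *\<^sub>R e4 p)) p"
    unfolding e1_def[abs_def] s_def
    by (rule has_partials_cong[OF has_partials_moving[OF d(3) DERIV_const DERIV_const d(4)]];
        simp only: e1_def e2_def e3_def e4_def moving_scaleR moving_add moving_diff;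
        rule moving_cong; ((simp; fail) | use alg in algebra))
  show "has_partials e2 (\<mu> s *\<^sub>R e4 p) (q s *\<^sub>R (\<rho> s *\<^sub>R e1 p + \<beta> s *\<^sub>R e3 p)) p"
    unfolding e2_def[abs_def] s_def
    by (rule has_partials_cong[OF has_partials_moving[OF DERIV_const d(6) d(7) DERIV_const]];
        simp only: e1_def e2_def e3_def e4_def moving_scaleR moving_add moving_diff;
        rule moving_cong; ((simp; fail) | use alg in algebra))
  show "has_partials e3 (c s *\<^sub>R e1 p) (q s *\<^sub>R (\<kappa> s *\<^sub>R e4 p - \<beta> s *\<^sub>R e2 p)) p"
    unfolding e3_def[abs_def] s_def
    by (rule has_partials_cong[OF has_partials_moving[OF d(4) DERIV_const DERIV_const d(3)]];
        simp only: e1_def e2_def e3_def e4_def moving_scaleR moving_add moving_diff;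
        rule moving_cong; ((simp; fail) | use alg in algebra))
  show "has_partials e4 (- \<mu> s *\<^sub>R e2 p) (q s *\<^sub>R (\<mu> s *\<^sub>R e1 p - \<kappa> s *\<^sub>R e3 p)) p"
    unfolding e4_def[abs_def] s_def
    by (rule has_partials_cong[OF has_partials_moving[OF DERIV_const d(8) d(6) DERIV_const]];
        simp only: e1_def e2_def e3_def e4_def moving_scaleR moving_add moving_diff;
        rule moving_cong; ((simp; fail) | use alg in algebra))
qed

section \<open>Orthonormality, and tangential and normal parts in the frame\<close>

lemma lor_frame:
  assumes "p \<in> U"
  shows "lor (e1 p) (e1 p) = -1" "lor (e2 p) (e2 p) = 1" "lor (e3 p) (e3 p) = 1" "lor (e4 p) (e4 p) = 1"
    "lor (e1 p) (e2 p) = 0" "lor (e1 p) (e3 p) = 0" "lor (e1 p) (e4 p) = 0"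
    "lor (e2 p) (e1 p) = 0" "lor (e2 p) (e3 p) = 0" "lor (e2 p) (e4 p) = 0"
    "lor (e3 p) (e1 p) = 0" "lor (e3 p) (e2 p) = 0" "lor (e3 p) (e4 p) = 0"
    "lor (e4 p) (e1 p) = 0" "lor (e4 p) (e2 p) = 0" "lor (e4 p) (e3 p) = 0"
proof -
  have s: "fst p \<in> I" using assms by auto
  show "lor (e1 p) (e1 p) = -1" "lor (e2 p) (e2 p) = 1" "lor (e3 p) (e3 p) = 1" "lor (e4 p) (e4 p) = 1"
    "lor (e1 p) (e2 p) = 0" "lor (e1 p) (e3 p) = 0" "lor (e1 p) (e4 p) = 0"
    "lor (e2 p) (e1 p) = 0" "lor (e2 p) (e3 p) = 0" "lor (e2 p) (e4 p) = 0"
    "lor (e3 p) (e1 p) = 0" "lor (e3 p) (e2 p) = 0" "lor (e3 p) (e4 p) = 0"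
    "lor (e4 p) (e1 p) = 0" "lor (e4 p) (e2 p) = 0" "lor (e4 p) (e3 p) = 0"
    unfolding e1_def e2_def e3_def e4_def lor_moving
    using unit_mn[OF s] arc_length[OF s] by (simp_all add: power2_eq_square mult.commute)
qed

lemma det_frame: assumes "p \<in> U" shows "det (vector [e1 p, e2 p, e3 p, e4 p] :: real^4^4) = 1"
proof -
  have s: "fst p \<in> I" using assms by auto
  show ?thesis unfolding e1_def e2_def e3_def e4_def det_moving unfolding det_4 vector_4
    using unit_mn[OF s] arc_length[OF s] by algebra
qed

lemma push_frame:
  assumes "p \<in> U"
  shows "push r E1 p = e1 p" "push r E2 p = e2 p"
proof -
  have "q (fst p) \<noteq> 0" using assms q_nonzero by auto
  then show "push r E1 p = e1 p" "push r E2 p = e2 p"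
    using has_partials_frechet_derivative[OF partials_r[OF assms]] by (simp_all add: push_def E1_def E2_def)
qed

lemma mem_normal_space_iff:
  assumes "p \<in> U"
  shows "v \<in> normal_space r p \<longleftrightarrow> lor v (e1 p) = 0 \<and> lor v (e2 p) = 0"
proof -
  have "q (fst p) \<noteq> 0" using assms q_nonzero by auto
  have *: "v \<in> normal_space r p \<longleftrightarrow> (\<forall>h. fst h * lor v (e1 p) + snd h * (q (fst p) * lor v (e2 p)) = 0)"
    unfolding normal_space_def tangent_space_def
    by (simp add: has_partials_frechet_derivative[OF partials_r[OF assms]] lor_simps mult.assoc)
  show ?thesis
  proof
    assume "v \<in> normal_space r p"
    then have z: "fst h * lor v (e1 p) + snd h * (q (fst p) * lor v (e2 p)) = 0" for h using * by blast
    from z[of "(1,0)"] z[of "(0,1)"] show "lor v (e1 p) = 0 \<and> lor v (e2 p) = 0"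
      using \<open>q (fst p) \<noteq> 0\<close> by simp
  next
    assume "lor v (e1 p) = 0 \<and> lor v (e2 p) = 0"
    then show "v \<in> normal_space r p" using * by simp
  qed
qed

lemma tangent_part_frame:
  assumes "p \<in> U"
    and "v = k1 *\<^sub>R e1 p + k2 *\<^sub>R e2 p + k3 *\<^sub>R e3 p + k4 *\<^sub>R e4 p"
  shows "tangent_part r p v = (k1, k2 / q (fst p))"
  unfolding tangent_part_def
proof (rule the_equality)
  have q: "q (fst p) \<noteq> 0" using assms q_nonzero by auto
  note fd = has_partials_frechet_derivative[OF partials_r[OF assms(1)]]
  show "v - frechet_derivative r (at p) (k1, k2 / q (fst p)) \<in> normal_space r p"
    using q by (simp add: fd assms(2) mem_normal_space_iff[OF assms(1)] lor_simps lor_frame[OF assms(1)])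
  fix Z assume "v - frechet_derivative r (at p) Z \<in> normal_space r p"
  then have "lor (v - frechet_derivative r (at p) Z) (e1 p) = 0" "lor (v - frechet_derivative r (at p) Z) (e2 p) = 0"
    using mem_normal_space_iff[OF assms(1)] by auto
  then have "k1 = fst Z" "k2 = snd Z * q (fst p)"
    by (simp_all add: fd assms(2) lor_simps lor_frame[OF assms(1)])
  then show "Z = (k1, k2 / q (fst p))" using q by (simp add: prod_eq_iff)
qed

lemma normal_part_frame:
  assumes "p \<in> U"
    and "v = k1 *\<^sub>R e1 p + k2 *\<^sub>R e2 p + k3 *\<^sub>R e3 p + k4 *\<^sub>R e4 p"
  shows "normal_part r p v = k3 *\<^sub>R e3 p + k4 *\<^sub>R e4 p"
proof -
  have q: "q (fst p) \<noteq> 0" using assms q_nonzero by auto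
  then show ?thesis
    unfolding normal_part_def tangent_part_frame[OF assms]
    by (simp add: assms(2) has_partials_frechet_derivative[OF partials_r[OF assms(1)]])
qed

text \<open>The coordinate fields commute, \<open>e3\<close> and \<open>e4\<close> are parallel in
  the normal bundle along the profile, and \<open>e3\<close> has normal \<open>t\<close>-derivative
  \<open>q \<kappa> e4\<close>. The normal curvature on \<open>e3\<close> is therefore the
  derivative of \<open>q \<kappa>\<close> times \<open>e4\<close>, which the Ricci equation
  evaluates.\<close>

lemma flat_normal_bundle_imp:
  assumes "flat_normal_bundle U r" "s \<in> I"
  shows "\<mu> s * (c s + \<beta> s) = 0"
proof -
  let ?X = "\<lambda>p::real\<times>real. (1::real, 0::real)" and ?Y = "\<lambda>p::real\<times>real. (0::real, 1::real)"
  \<comment> \<open>The coefficients depend on \<open>s\<close> only, so one admissible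
    \<open>t\<close> suffices.\<close>
  let ?p = "(s, pi)"
  have p: "?p \<in> U" using assms(2) by simp
  have "smooth_on U ?X" "smooth_on U ?Y" using smooth_on_const[OF open_U] by auto
  moreover have "\<forall>y\<in>U. e3 y \<in> normal_space r y"
    by (intro ballI) (simp add: mem_normal_space_iff lor_frame)
  ultimately have 0: "normal_curv r ?X ?Y e3 ?p = 0"
    using smooth_frame(3) assms(1)[unfolded flat_normal_bundle_def, rule_format, OF _ p, of ?X ?Y e3] by simp
  have X: "normal_conn r ?X e3 y = 0" if y: "y \<in> U" for y
    unfolding normal_conn_def has_partials_along[OF partials_frame(3)[OF y]]
    using normal_part_frame[OF y, of _ "c (fst y)" 0 0 0] by simp
  have Y: "normal_conn r ?Y e3 y = (q (fst y) * \<kappa> (fst y)) *\<^sub>R e4 y" if y: "y \<in> U" for y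
    unfolding normal_conn_def has_partials_along[OF partials_frame(3)[OF y]]
    using normal_part_frame[OF y, of _ 0 "- q (fst y) * \<beta> (fst y)" 0 "q (fst y) * \<kappa> (fst y)"]
    by (simp add: scaleR_diff_right)
  have "has_partials (normal_conn r ?X e3) 0 0 ?p"
    by (rule has_partials_transform[OF has_partials_const[of 0] open_U p]) (simp add: X)
  then have YX: "normal_conn r ?Y (normal_conn r ?X e3) ?p = 0"
    unfolding normal_conn_def[of r ?Y] using normal_part_frame[OF p, of 0 0 0 0 0]
    by (simp add: has_partials_along)
  have "((\<lambda>s. q s * \<kappa> s) has_real_derivative q s * (\<mu> s * (c s + \<beta> s))) (at (fst ?p))"
    using deriv_forms(3)[OF assms(2)] by simp
  note has_partials_scaleR[OF has_partials_fst[OF this] partials_frame(4)[OF p]]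
  from has_partials_transform[OF this open_U p, of "normal_conn r ?Y e3"]
  have "along ?X (normal_conn r ?Y e3) ?p = (q s * \<kappa> s) *\<^sub>R (- \<mu> s *\<^sub>R e2 ?p) + (q s * (\<mu> s * (c s + \<beta> s))) *\<^sub>R e4 ?p"
    by (subst has_partials_along) (auto simp: Y)
  then have XY: "normal_conn r ?X (normal_conn r ?Y e3) ?p = (q s * (\<mu> s * (c s + \<beta> s))) *\<^sub>R e4 ?p"
    unfolding normal_conn_def[of r ?X]
    using normal_part_frame[OF p, of _ 0 "- q s * \<kappa> s * \<mu> s" 0 "q s * (\<mu> s * (c s + \<beta> s))"] by simp
  have "bracket ?X ?Y = (\<lambda>p. 0)"
    by (simp add: bracket_def fun_eq_iff has_partials_along[OF has_partials_const])
  then have br: "normal_conn r (bracket ?X ?Y) e3 ?p = 0"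
    unfolding normal_conn_def has_partials_along[OF partials_frame(3)[OF p]]
    using normal_part_frame[OF p, of 0 0 0 0 0] by simp
  have "(q s * (\<mu> s * (c s + \<beta> s))) *\<^sub>R e4 ?p = 0"
    using 0 unfolding normal_curv_def XY YX br by simp
  moreover have "e4 ?p \<noteq> 0" using lor_frame(4)[OF p] by (auto simp: lor_simps)
  ultimately show ?thesis using q_nonzero[OF assms(2)] by simp
qed

section \<open>Laplacian of the Gauss map in the adapted frame\<close>

lemma oriented_frame: "oriented_frame U r E1 E2 e3 e4"
  unfolding oriented_frame_def
proof (intro conjI ballI smooth_E smooth_frame)
  fix p assume p: "p \<in> U"
  note * = push_frame[OF p] lor_frame[OF p]
  show "\<bar>lor (push r E1 p) (push r E1 p)\<bar> = 1" "\<bar>lor (push r E2 p) (push r E2 p)\<bar> = 1"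
    "lor (push r E1 p) (push r E2 p) = 0" "\<bar>lor (e3 p) (e3 p)\<bar> = 1" "\<bar>lor (e4 p) (e4 p)\<bar> = 1"
    "lor (e3 p) (e4 p) = 0" by (simp_all add: *)
  show "e3 p \<in> normal_space r p" "e4 p \<in> normal_space r p"
    by (simp_all add: mem_normal_space_iff[OF p] *)
  show "fst (E1 p) * snd (E2 p) - snd (E1 p) * fst (E2 p) > 0"
    using p q_pos by (auto simp: E1_def E2_def)
  show "det (vector [push r E1 p, push r E2 p, e3 p, e4 p] :: real^4^4) > 0"
    by (simp add: * det_frame[OF p])
qed

definition "\<nu> y = wedge (e3 y) (e4 y)"

lemma induced_conn_frame:
  assumes p: "p \<in> U"
  shows "induced_conn r E1 E1 p = (0, 0)" "induced_conn r E2 E2 p = (\<rho> (fst p), 0)"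
proof -
  have q: "q (fst p) \<noteq> 0" using p q_nonzero by auto
  have "has_partials (push r E1) (c (fst p) *\<^sub>R e3 p) (q (fst p) *\<^sub>R (\<rho> (fst p) *\<^sub>R e2 p + \<mu> (fst p) *\<^sub>R e4 p)) p"
    by (rule has_partials_transform[OF partials_frame(1)[OF p] open_U p]) (simp add: push_frame)
  then show "induced_conn r E1 E1 p = (0, 0)"
    unfolding induced_conn_def
    by (simp add: has_partials_along E1_def tangent_part_frame[OF p, of _ 0 0 "c (fst p)" 0])
  have "has_partials (push r E2) (\<mu> (fst p) *\<^sub>R e4 p) (q (fst p) *\<^sub>R (\<rho> (fst p) *\<^sub>R e1 p + \<beta> (fst p) *\<^sub>R e3 p)) p"
    by (rule has_partials_transform[OF partials_frame(2)[OF p] open_U p]) (simp add: push_frame)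
  then show "induced_conn r E2 E2 p = (\<rho> (fst p), 0)"
    unfolding induced_conn_def using q
    by (simp add: has_partials_along E2_def tangent_part_frame[OF p, of _ "\<rho> (fst p)" 0 "\<beta> (fst p)" 0])
qed

lemma partials_gauss_map:
  assumes p: "p \<in> U"
  defines "s \<equiv> fst p"
  shows "has_partials \<nu> (c s *\<^sub>R wedge (e1 p) (e4 p) + \<mu> s *\<^sub>R wedge (e2 p) (e3 p))
    (q s *\<^sub>R ((- \<beta> s) *\<^sub>R wedge (e2 p) (e4 p) + (- \<mu> s) *\<^sub>R wedge (e1 p) (e3 p))) p"
  unfolding \<nu>_def[abs_def] s_def
  by (rule has_partials_cong[OF has_partials_wedge[OF partials_frame(3)[OF p] partials_frame(4)[OF p]]])
    (simp_all add: vec_eq_iff wedge_def algebra_simps)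

lemma along_gauss_map:
  assumes p: "p \<in> U"
  shows "along E1 \<nu> p = c (fst p) *\<^sub>R wedge (e1 p) (e4 p) + \<mu> (fst p) *\<^sub>R wedge (e2 p) (e3 p)"
    "along E2 \<nu> p = (- \<beta> (fst p)) *\<^sub>R wedge (e2 p) (e4 p) + (- \<mu> (fst p)) *\<^sub>R wedge (e1 p) (e3 p)"
  using p q_nonzero by (auto simp: has_partials_along[OF partials_gauss_map[OF p]] E1_def E2_def)

text \<open>The Codazzi equations replace the derivatives of \<mu> and \<beta>, so that
  \<open>deriv c\<close> is the only derivative left.\<close>

lemma along_along_gauss_map:
  assumes p: "p \<in> U"
  defines "s \<equiv> fst p"
  shows "along E1 (along E1 \<nu>) p = ((c s)\<^sup>2 - (\<mu> s)\<^sup>2) *\<^sub>R wedge (e3 p) (e4 p) - (2 * c s * \<mu> s) *\<^sub>R wedge (e1 p) (e2 p)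
      + deriv c s *\<^sub>R wedge (e1 p) (e4 p) + (c s * \<kappa> s - 2 * \<rho> s * \<mu> s) *\<^sub>R wedge (e2 p) (e3 p)" (is ?th1)
    "along E2 (along E2 \<nu>) p = ((\<mu> s)\<^sup>2 - (\<beta> s)\<^sup>2) *\<^sub>R wedge (e3 p) (e4 p) + (2 * \<beta> s * \<mu> s) *\<^sub>R wedge (e1 p) (e2 p)
      - (\<beta> s * \<rho> s + \<mu> s * \<kappa> s) *\<^sub>R wedge (e1 p) (e4 p) + (\<beta> s * \<kappa> s - \<mu> s * \<rho> s) *\<^sub>R wedge (e2 p) (e3 p)" (is ?th2)
proof -
  have s: "fst p \<in> I" using p by auto
  have mm: "has_partials (\<lambda>y. - \<mu> (fst y)) (- (c (fst p) * \<kappa> (fst p) - 2 * \<rho> (fst p) * \<mu> (fst p))) 0 p"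
    by (rule has_partials_fst[OF DERIV_minus[OF deriv_forms(1)[OF s]]])
  have mb: "has_partials (\<lambda>y. - \<beta> (fst y)) (- (- \<rho> (fst p) * (c (fst p) + \<beta> (fst p)) - \<mu> (fst p) * \<kappa> (fst p))) 0 p"
    by (rule has_partials_fst[OF DERIV_minus[OF deriv_forms(2)[OF s]]])
  note f = partials_frame[OF p]
  note w14 = has_partials_wedge[OF f(1) f(4)] and w23 = has_partials_wedge[OF f(2) f(3)]
    and w24 = has_partials_wedge[OF f(2) f(4)] and w13 = has_partials_wedge[OF f(1) f(3)]
  note P = has_partials_add[OF has_partials_scaleR[OF has_partials_fst[OF deriv_profile(5)[OF s]] w14]
      has_partials_scaleR[OF has_partials_fst[OF deriv_forms(1)[OF s]] w23]]
  note P' = has_partials_transform[OF P open_U p, of "along E1 \<nu>"]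
  show ?th1
    by (subst has_partials_along[OF P']; simp add: along_gauss_map E1_def s_def; simp add: vec_eq_iff wedge_def power2_eq_square algebra_simps)
  note Q = has_partials_add[OF has_partials_scaleR[OF mb w24] has_partials_scaleR[OF mm w13]]
  note Q' = has_partials_transform[OF Q open_U p, of "along E2 \<nu>"]
  have "q (fst p) \<noteq> 0" using q_nonzero[OF s] .
  show ?th2
    apply (subst has_partials_along[OF Q'])
     apply (simp add: along_gauss_map)
    using \<open>q (fst p) \<noteq> 0\<close>
    apply (simp add: E2_def s_def wedge_simps scaleR_add_right scaleR_diff_right)
    apply (simp add: vec_eq_iff wedge_def power2_eq_square algebra_simps)
    done
qed

lemma laplacian_gauss_map:
  assumes p: "p \<in> U"
  defines "s \<equiv> fst p"
  shows "laplacian r E1 E2 \<nu> p =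
    ((c s)\<^sup>2 + (\<beta> s)\<^sup>2 - 2 * (\<mu> s)\<^sup>2) *\<^sub>R wedge (e3 p) (e4 p) - (2 * \<mu> s * (c s + \<beta> s)) *\<^sub>R wedge (e1 p) (e2 p)
      + (deriv c s + \<rho> s * (c s + \<beta> s) + \<mu> s * \<kappa> s) *\<^sub>R wedge (e1 p) (e4 p)
      + (\<kappa> s * (c s - \<beta> s)) *\<^sub>R wedge (e2 p) (e3 p)"
proof -
  have "along (induced_conn r E1 E1) \<nu> p = 0"
    by (simp add: has_partials_along[OF partials_gauss_map[OF p]] induced_conn_frame[OF p])
  moreover have "along (induced_conn r E2 E2) \<nu> p =
      \<rho> s *\<^sub>R (c s *\<^sub>R wedge (e1 p) (e4 p) + \<mu> s *\<^sub>R wedge (e2 p) (e3 p))"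
    by (simp add: has_partials_along[OF partials_gauss_map[OF p]] induced_conn_frame[OF p] s_def)
  ultimately show ?thesis
    unfolding laplacian_def push_frame[OF p] lor_frame[OF p] along_along_gauss_map[OF p]
    by (simp add: vec_eq_iff s_def power2_eq_square algebra_simps)
qed

text \<open>Both sides are paired with the six basis bivectors. The Laplacian has no
  \<open>e1, e3\<close> or \<open>e2, e4\<close> term, and flatness removes its
  \<open>e1, e2\<close> term. The minus sign in the fourth equation comes from the timelike
  \<open>e1\<close>.\<close>

lemma gauss_map_eq_components:
  assumes eq: "gauss_map_eq U r f C" and p: "p \<in> U"
    and flat: "\<mu> (fst p) * (c (fst p) + \<beta> (fst p)) = 0"
  defines "s \<equiv> fst p"
  shows "f p * contraction C (e1 p) (e2 p) = 0" "f p * contraction C (e1 p) (e3 p) = 0"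
    "f p * contraction C (e2 p) (e4 p) = 0"
    "f p * contraction C (e1 p) (e4 p) = - (deriv c s + \<rho> s * (c s + \<beta> s) + \<mu> s * \<kappa> s)"
    "f p * contraction C (e2 p) (e3 p) = \<kappa> s * (c s - \<beta> s)"
    "f p * (1 + contraction C (e3 p) (e4 p)) = (c s)\<^sup>2 + (\<beta> s)\<^sup>2 - 2 * (\<mu> s)\<^sup>2"
proof -
  have "laplacian r E1 E2 \<nu> p = f p *\<^sub>R (\<nu> p + C)"
    using eq[unfolded gauss_map_eq_def, rule_format, of U E1 E2 e3 e4] open_U oriented_frame p
    unfolding \<nu>_def[abs_def] Let_def by (cases p) simp
  then have "contraction (laplacian r E1 E2 \<nu> p) u v = f p * (contraction (\<nu> p) u v + contraction C u v)" for u v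
    by (simp add: contraction_scaleR contraction_add)
  note * = this[unfolded laplacian_gauss_map[OF p] \<nu>_def contraction_add contraction_diff contraction_scaleR contraction_wedge]
  note lf = lor_frame[OF p]
  have fl: "\<mu> (fst p) = 0 \<or> c (fst p) + \<beta> (fst p) = 0" using flat by simp
  show "f p * contraction C (e1 p) (e2 p) = 0" using *[of "e1 p" "e2 p"] fl by (auto simp: lf)
  show "f p * contraction C (e1 p) (e3 p) = 0" using *[of "e1 p" "e3 p"] by (simp add: lf)
  show "f p * contraction C (e2 p) (e4 p) = 0" using *[of "e2 p" "e4 p"] by (simp add: lf)
  show "f p * contraction C (e1 p) (e4 p) = - (deriv c s + \<rho> s * (c s + \<beta> s) + \<mu> s * \<kappa> s)"
    using *[of "e1 p" "e4 p"] by (simp add: lf s_def)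
  show "f p * contraction C (e2 p) (e3 p) = \<kappa> s * (c s - \<beta> s)"
    using *[of "e2 p" "e3 p"] by (simp add: lf s_def)
  show "f p * (1 + contraction C (e3 p) (e4 p)) = (c s)\<^sup>2 + (\<beta> s)\<^sup>2 - 2 * (\<mu> s)\<^sup>2"
    using *[of "e3 p" "e4 p"] by (simp add: lf s_def)
qed

text \<open>Where \<open>f\<close> does not vanish, three components of the constant \<open>C\<close> are zero; the relations
  come from differentiating these equations.\<close>

lemma gauss_map_eq_relations:
  assumes eq: "gauss_map_eq U r f C" and cont: "continuous_on U f" and C: "C \<in> bivectors"
    and p: "p \<in> U" and f: "f p \<noteq> 0"
    and flat: "\<And>s. s \<in> I \<Longrightarrow> \<mu> s * (c s + \<beta> s) = 0"
  defines "s \<equiv> fst p" and "C14 \<equiv> contraction C (e1 p) (e4 p)" and "C23 \<equiv> contraction C (e2 p) (e3 p)"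
    and "C34 \<equiv> contraction C (e3 p) (e4 p)"
  shows "\<mu> s * C14 - c s * C23 = 0" "\<rho> s * C23 - \<mu> s * C34 + \<kappa> s * C14 = 0"
    "\<rho> s * C14 + \<beta> s * C34 - \<kappa> s * C23 = 0"
    "C14 = 0 \<Longrightarrow> C23 = 0 \<Longrightarrow> C34 = 0 \<Longrightarrow> C = 0"
proof -
  \<comment> \<open>An open neighbourhood on which the three components stay zero, which makes their
    derivatives at \<open>p\<close> vanish as well.\<close>
  define W where "W = U \<inter> f -` (- {0})"
  have W: "open W" "W \<subseteq> U" "p \<in> W"
    unfolding W_def using open_U cont p f by (auto intro!: continuous_open_preimage)
  have z: "contraction C (e1 y) (e2 y) = 0" "contraction C (e1 y) (e3 y) = 0" "contraction C (e2 y) (e4 y) = 0"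
    if "y \<in> W" for y
  proof -
    have y: "y \<in> U" "f y \<noteq> 0" "fst y \<in> I" using that by (auto simp: W_def)
    show "contraction C (e1 y) (e2 y) = 0" "contraction C (e1 y) (e3 y) = 0" "contraction C (e2 y) (e4 y) = 0"
      using gauss_map_eq_components(1-3)[OF eq y(1) flat[OF y(3)]] y(2) by simp_all
  qed
  have zero: "P = 0 \<and> Q = 0" if "has_partials F P Q p" "\<And>y. y \<in> W \<Longrightarrow> F y = 0" for F :: "_ \<Rightarrow> real" and P Q
    using has_partials_unique[OF has_partials_transform[OF that(1) W(1,3) that(2)] has_partials_const] by simp
  have s: "s \<in> I" using p by (auto simp: s_def)
  note zp = z[OF W(3)] and sw = contraction_swap[OF C] and self = contraction_self[OF C]
  note pf = partials_frame[OF p, folded s_def]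
  \<comment> \<open>The three relations are, in order, the \<open>s\<close>-derivative of the
    \<open>e1, e2\<close> component and the \<open>t\<close>-derivatives of the
    \<open>e1, e3\<close> and \<open>e2, e4\<close> components.\<close>
  have "contraction C (e1 p) (\<mu> s *\<^sub>R e4 p) + contraction C (c s *\<^sub>R e3 p) (e2 p) = 0"
    using zero[OF has_partials_contraction[OF pf(1,2)] z(1)] by blast
  then show "\<mu> s * C14 - c s * C23 = 0"
    using sw[of "e3 p" "e2 p"] by (simp add: contraction_simps C14_def C23_def)
  have "contraction C (e1 p) (q s *\<^sub>R (\<kappa> s *\<^sub>R e4 p - \<beta> s *\<^sub>R e2 p))
      + contraction C (q s *\<^sub>R (\<rho> s *\<^sub>R e2 p + \<mu> s *\<^sub>R e4 p)) (e3 p) = 0"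
    using zero[OF has_partials_contraction[OF pf(1,3)] z(2)] by blast
  then have "q s * (\<rho> s * C23 - \<mu> s * C34 + \<kappa> s * C14) = 0"
    using sw[of "e4 p" "e3 p"] zp by (simp add: contraction_simps C14_def C23_def C34_def algebra_simps)
  then show "\<rho> s * C23 - \<mu> s * C34 + \<kappa> s * C14 = 0" using q_nonzero[OF s] by simp
  have "contraction C (e2 p) (q s *\<^sub>R (\<mu> s *\<^sub>R e1 p - \<kappa> s *\<^sub>R e3 p))
      + contraction C (q s *\<^sub>R (\<rho> s *\<^sub>R e1 p + \<beta> s *\<^sub>R e3 p)) (e4 p) = 0"
    using zero[OF has_partials_contraction[OF pf(2,4)] z(3)] by blast
  then have "q s * (\<rho> s * C14 + \<beta> s * C34 - \<kappa> s * C23) = 0"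
    using sw[of "e2 p" "e1 p"] zp by (simp add: contraction_simps C14_def C23_def C34_def algebra_simps)
  then show "\<rho> s * C14 + \<beta> s * C34 - \<kappa> s * C23 = 0" using q_nonzero[OF s] by simp
  assume 0: "C14 = 0" "C23 = 0" "C34 = 0"
  show "C = 0"
  proof (rule contraction_eq_0_imp_0)
    show "det (vector [e1 p, e2 p, e3 p, e4 p] :: real^4^4) \<noteq> 0" by (simp add: det_frame[OF p])
    fix u v assume "u \<in> {e1 p, e2 p, e3 p, e4 p}" "v \<in> {e1 p, e2 p, e3 p, e4 p}"
    then show "contraction C u v = 0"
      using zp 0 self sw[of "e2 p" "e1 p"] sw[of "e3 p" "e1 p"] sw[of "e4 p" "e1 p"]
        sw[of "e3 p" "e2 p"] sw[of "e4 p" "e2 p"] sw[of "e4 p" "e3 p"]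
      unfolding C14_def C23_def C34_def by auto
  qed
qed

section \<open>Consequences of the second-kind equation for the profile\<close>

lemma w1_nonzero: "s \<in> I \<Longrightarrow> w1 s \<noteq> 0"
  using arc_length[of s] zero_le_power2[of "x1 s"] by (smt (verit) power2_less_eq_zero_iff)

lemma second_kind_imp_\<mu>_eq_0:
  assumes eq: "gauss_map_eq U r f C" and cont: "continuous_on U f" and C: "C \<in> bivectors" "C \<noteq> 0"
    and flat: "\<And>s. s \<in> I \<Longrightarrow> \<mu> s * (c s + \<beta> s) = 0"
    and s0: "s0 \<in> I"
  shows "\<mu> s0 = 0"
proof (rule ccontr)
  assume ne: "\<mu> s0 \<noteq> 0"
  define J where "J = I \<inter> \<mu> -` (- {0})"
  have "continuous_on I \<mu>"
    by (intro continuous_at_imp_continuous_on ballI DERIV_isCont[OF deriv_forms(1)])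
  then have J: "open J" "s0 \<in> J" "J \<subseteq> I"
    unfolding J_def using open_I ne s0 by (auto intro!: continuous_open_preimage)
  have deriv_eq: "g' = h'" if "s \<in> J" "\<And>z. z \<in> J \<Longrightarrow> g z = h z"
    "(g has_real_derivative g') (at s)" "(h has_real_derivative h') (at s)" for g h g' h' s
    using DERIV_unique[OF has_field_derivative_transform_within_open[OF that(3) J(1) that(1)] that(4)] that(2) by blast
  have c: "c s = - \<beta> s" if "s \<in> J" for s
    using flat[of s] that by (auto simp: J_def)
  have c': "deriv c s = \<mu> s * \<kappa> s" if "s \<in> J" for s
  proof -
    have "s \<in> I" using that J by auto
    from deriv_eq[OF that c deriv_profile(5)[OF this] DERIV_minus[OF deriv_forms(2)[OF this]]]
    show ?thesis using c[OF that] by simp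
  qed
  have \<kappa>: "\<kappa> s = 0" if "s \<in> J" for s
  proof -
    let ?p = "(s, pi)"
    have s: "s \<in> I" "\<mu> s \<noteq> 0" and p: "?p \<in> U" using that by (auto simp: J_def)
    note comp = gauss_map_eq_components[OF eq p flat, simplified, OF s(1)]
    \<comment> \<open>With \<open>c = - \<beta>\<close> and \<open>deriv c = \<mu> \<kappa>\<close>,
      the components of \<open>C\<close> times \<open>f\<close> are
      \<open>- 2 \<mu> \<kappa>\<close> for \<open>e1, e4\<close> and \<open>2 c \<kappa>\<close>
      for \<open>e2, e3\<close>. If \<open>f\<close> is zero both vanish; otherwise the first
      relation links them.\<close>
    have "\<mu> s * (2 * \<mu> s * \<kappa> s) + c s * (\<kappa> s * (2 * c s)) = 0"
    proof (cases "f ?p = 0")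
      case True
      then show ?thesis using comp(4,5) c[OF that] c'[OF that] by auto
    next
      case False
      have "\<mu> s * (f ?p * contraction C (e1 ?p) (e4 ?p)) - c s * (f ?p * contraction C (e2 ?p) (e3 ?p)) = 0"
        using gauss_map_eq_relations(1)[OF eq cont C(1) p False flat] by simp
      then show ?thesis using comp(4,5) c[OF that] c'[OF that] by simp algebra
    qed
    then have "\<kappa> s * ((\<mu> s)\<^sup>2 + (c s)\<^sup>2) = 0" by algebra
    then show ?thesis using s(2) by simp
  qed
  have F: "(\<beta> s)\<^sup>2 = (\<mu> s)\<^sup>2" if "s \<in> J" for s
  proof -
    let ?p = "(s, pi)"
    have s: "s \<in> I" "\<mu> s \<noteq> 0" and p: "?p \<in> U" using that by (auto simp: J_def)
    note comp = gauss_map_eq_components[OF eq p flat, simplified, OF s(1)]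
    \<comment> \<open>A nonzero value would annihilate the last three components in turn, hence
      \<open>C\<close>. So \<open>f\<close> is zero and the \<open>e3, e4\<close> equation gives the
      claim.\<close>
    have "f ?p = 0"
    proof (rule ccontr)
      assume f: "f ?p \<noteq> 0"
      note rel = gauss_map_eq_relations[OF eq cont C(1) p f flat, simplified]
      have "contraction C (e1 ?p) (e4 ?p) = 0" "contraction C (e2 ?p) (e3 ?p) = 0"
        using comp(4,5) f \<kappa>[OF that] c[OF that] c'[OF that] by auto
      moreover from this have "contraction C (e3 ?p) (e4 ?p) = 0"
        using rel(2) s(2) by simp
      ultimately have "C = 0" using rel(4) by blast
      then show False using C(2) by simp
    qed
    then show ?thesis using comp(6) c[OF that] by simp
  qed
  have \<rho>: "\<rho> s = 0" if "s \<in> J" for s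
  proof -
    have s: "s \<in> I" "\<mu> s \<noteq> 0" using that by (auto simp: J_def)
    have "((\<lambda>s. (\<beta> s)\<^sup>2) has_real_derivative 2 * \<beta> s * (- \<rho> s * (c s + \<beta> s) - \<mu> s * \<kappa> s)) (at s)"
      "((\<lambda>s. (\<mu> s)\<^sup>2) has_real_derivative 2 * \<mu> s * (c s * \<kappa> s - 2 * \<rho> s * \<mu> s)) (at s)"
      by (auto intro!: derivative_eq_intros deriv_forms[OF s(1)])
    \<comment> \<open>By \<open>c + \<beta> = 0\<close> and \<open>\<kappa> = 0\<close> the left
      derivative is zero and the right one is \<open>- 4 \<rho> \<mu>\<^sup>2\<close>.\<close>
    from deriv_eq[OF that F this] show ?thesis using \<kappa>[OF that] c[OF that] s(2) by simp
  qed
  have w: "w s = 0" if "s \<in> J" for s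
  proof -
    have s: "s \<in> I" using that by (auto simp: J_def)
    have "b * m s * x1 s = a * n s * w1 s" "a * m s * x1 s + b * n s * w1 s = 0"
      using q_mult(3,6)[OF s] \<kappa>[OF that] \<rho>[OF that] by simp_all
    \<comment> \<open>Eliminating \<open>m x1\<close> from the two linear equations.\<close>
    then have "(a\<^sup>2 + b\<^sup>2) * (n s * w1 s) = 0" by algebra
    then have "n s = 0" using a_nonzero w1_nonzero[OF s] by simp
    then show ?thesis using q_nonzero[OF s] b_nonzero by (simp add: n_def)
  qed
  have "w1 s0 = 0"
    using deriv_eq[OF J(2) w deriv_profile(2)[OF s0] DERIV_const] by blast
  then show False using w1_nonzero[OF s0] by simp
qed

lemma second_kind_imp_x_eq_0:
  assumes eq: "gauss_map_eq U r f C" and cont: "continuous_on U f" and C: "C \<in> bivectors" "C \<noteq> 0"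
    and flat: "\<And>s. s \<in> I \<Longrightarrow> \<mu> s * (c s + \<beta> s) = 0"
    and s0: "s0 \<in> I"
  shows "x s0 = 0"
proof (rule ccontr)
  assume ne: "x s0 \<noteq> 0"
  have \<mu>: "\<mu> s = 0" if "s \<in> I" for s
    using second_kind_imp_\<mu>_eq_0[OF eq cont C flat that] .
  have xw: "x s * w1 s = w s * x1 s" if "s \<in> I" for s
  proof -
    \<comment> \<open>This Wronskian expression is \<open>q\<^sup>2 \<mu>\<close>; it is also the
      numerator of the derivative of \<open>x / w\<close>, up to sign and the factor
      \<open>a b\<close>.\<close>
    have "a * b * (x s * w1 s - w s * x1 s) = 0"
      using q_mult(1,2,4)[OF that] \<mu>[OF that] by algebra
    then show ?thesis using a_nonzero b_nonzero by simp
  qed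
  have w: "w s \<noteq> 0" if "s \<in> I" for s
  proof
    assume "w s = 0"
    then have "x s = 0" using xw[OF that] w1_nonzero[OF that] by simp
    with \<open>w s = 0\<close> show False using immersed[OF that] by simp
  qed
  have "\<exists>k. \<forall>s\<in>I. x s / w s = k"
  proof (rule has_field_derivative_zero_constant)
    show "convex I" using interval_I is_interval_convex by blast
    fix s assume s: "s \<in> I"
    have "((\<lambda>s. x s / w s) has_real_derivative (x1 s * w s - x s * w1 s) / (w s * w s)) (at s)"
      by (rule DERIV_divide[OF deriv_profile(1,2)[OF s] w[OF s]])
    then show "((\<lambda>s. x s / w s) has_real_derivative 0) (at s within I)"
      using xw[OF s] by (auto intro: has_field_derivative_at_within simp: mult.commute)
  qed
  then obtain k where k: "\<And>s. s \<in> I \<Longrightarrow> x s = k * w s" using w by (force simp: field_simps)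
  have k0: "k \<noteq> 0" using ne k[OF s0] by auto
  have x1: "x1 s = k * w1 s" if "s \<in> I" for s
    using xw[OF that] k[OF that] w[OF that] by simp
  have "c s = 0" if s: "s \<in> I" for s
  proof -
    have "(x1 has_real_derivative k * (c s * x1 s)) (at s)"
      by (rule has_field_derivative_transform_within_open[OF DERIV_cmult[OF deriv_profile(4)[OF s]] open_I s])
        (simp add: x1)
    from DERIV_unique[OF this deriv_profile(3)[OF s]] have "c s * (w1 s - k * x1 s) = 0" by algebra
    moreover have "w1 s * (w1 s - k * x1 s) = 1" using arc_length[OF s] x1[OF s] by algebra
    ultimately show ?thesis by auto
  qed
  note c0 = this
  then have c: "c s0 = 0" using s0 .
  have "deriv c s0 = 0"
    by (rule DERIV_unique[OF deriv_profile(5)[OF s0]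
          has_field_derivative_transform_within_open[OF DERIV_const[of 0] open_I s0]]) (simp add: c0)
  let ?p = "(s0, pi)"
  have p: "?p \<in> U" using s0 by simp
  have qn: "q s0 \<noteq> 0" using q_nonzero[OF s0] .
  have w0: "w1 s0 \<noteq> 0" "w s0 \<noteq> 0" using w1_nonzero w s0 by auto
  \<comment> \<open>The factors that appear in \<open>q\<^sup>2 \<beta>\<close>,
    \<open>q\<^sup>2 \<rho>\<close> and \<open>q\<^sup>2 \<kappa>\<close> after substituting
    \<open>x = k w\<close>. That \<open>D\<close> is nonzero expresses that the line is
    timelike.\<close>
  define A B D where "A = a\<^sup>2 + b\<^sup>2" and "B = (a * k)\<^sup>2 + b\<^sup>2" and "D = 1 - k\<^sup>2"
  have "(w1 s0)\<^sup>2 * D = 1" using arc_length[OF s0] x1[OF s0] unfolding D_def by algebra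
  then have ABD: "A \<noteq> 0" "B \<noteq> 0" "D \<noteq> 0"
    unfolding A_def B_def using b_nonzero by (auto simp: sum_power2_eq_zero_iff)
  have "q s0 * (q s0 * \<beta> s0) = - A * k * w s0 * w1 s0"
    "q s0 * (q s0 * \<rho> s0) = B * w s0 * w1 s0"
    "q s0 * (q s0 * \<kappa> s0) = - a * b * D * w s0 * w1 s0"
    unfolding A_def B_def D_def using q_mult[OF s0] k[OF s0] x1[OF s0] by algebra+
  then have nz: "\<beta> s0 \<noteq> 0" "\<rho> s0 \<noteq> 0" "\<kappa> s0 \<noteq> 0"
    using ABD w0 qn k0 a_nonzero b_nonzero by auto
  note comp = gauss_map_eq_components[OF eq p flat, simplified, OF s0]
  have f: "f ?p \<noteq> 0" using comp(6) c \<mu>[OF s0] nz(1) by auto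
  have "f ?p * (\<rho> s0 * contraction C (e2 ?p) (e3 ?p) + \<kappa> s0 * contraction C (e1 ?p) (e4 ?p)) = 0"
    using gauss_map_eq_relations(2)[OF eq cont C(1) p f flat] \<mu>[OF s0] by simp
  \<comment> \<open>Here \<open>f\<close> times the \<open>e2, e3\<close> component is
    \<open>- \<kappa> \<beta>\<close> and \<open>f\<close> times the \<open>e1, e4\<close> component
    is \<open>- \<rho> \<beta>\<close>, so the two summands coincide instead of cancelling.\<close>
  then have "\<rho> s0 * \<kappa> s0 * \<beta> s0 = 0"
    using comp(4,5) c \<open>deriv c s0 = 0\<close> \<mu>[OF s0] by simp algebra
  then show False using nz by simp
qed

end

section \<open>Surfaces in a timelike plane\<close>

lemma has_derivative_const_on_open:
  assumes "(g has_derivative D) (at p)" "open V" "p \<in> V" "\<And>y. y \<in> V \<Longrightarrow> g y = k"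
  shows "D h = 0"
proof -
  have "((\<lambda>y. k) has_derivative D) (at p)"
    using assms by (intro has_derivative_transform_within_open[OF assms(1,2,3)]) auto
  from has_derivative_unique[OF this has_derivative_const] show ?thesis by simp
qed

text \<open>The derivative of a unit normal is orthogonal to the fixed tangent vectors
  \<open>g1\<close>, \<open>g2\<close> and to the normal itself, so only the direction of the other
  normal \<open>g3\<close> remains.\<close>

lemma frame_derivative_parallel:
  fixes e :: "real \<times> real \<Rightarrow> real^4" and g3 :: "real^4"
  assumes V: "open V" "p \<in> V" and D: "(e has_derivative D) (at p)"
    and unit: "\<And>y. y \<in> V \<Longrightarrow> \<bar>lor (e y) (e y)\<bar> = 1" and unit': "\<bar>lor (g3) (g3)\<bar> = 1"
    and orth: "lor (e p) (g3) = 0"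
    and perp: "\<And>y. y \<in> V \<Longrightarrow> lor (e y) g1 = 0" "\<And>y. y \<in> V \<Longrightarrow> lor (e y) g2 = 0"
    and perp': "lor (g3) g1 = 0" "lor (g3) g2 = 0"
    and det: "det (vector [g1, g2, e p, g3] :: real^4^4) \<noteq> 0"
  shows "\<exists>k. D h = k *\<^sub>R g3"
proof -
  note lor_deriv = bounded_bilinear.FDERIV[OF bounded_bilinear_lor]
  have "lor (e p) 0 + lor (D h) g = 0" if "\<And>y. y \<in> V \<Longrightarrow> lor (e y) g = 0" for g
    by (rule has_derivative_const_on_open[OF lor_deriv[OF D has_derivative_const] V that])
  then have g: "lor (D h) g1 = 0" "lor (D h) g2 = 0" using perp by (auto simp: lor_simps)
  \<comment> \<open>The square of \<open>lor (e y) (e y)\<close> is differentiated because only its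
    absolute value is prescribed; this avoids arguing that the sign is locally constant.\<close>
  have "lor (e p) (e p) * (lor (e p) (D h) + lor (D h) (e p)) + (lor (e p) (D h) + lor (D h) (e p)) * lor (e p) (e p) = 0"
  proof (rule has_derivative_const_on_open[OF has_derivative_mult[OF lor_deriv[OF D D] lor_deriv[OF D D]] V])
    fix y assume "y \<in> V"
    then show "lor (e y) (e y) * lor (e y) (e y) = 1" using unit[of y] by (metis abs_mult_self_eq mult_1)
  qed
  moreover have "lor (e p) (e p) \<noteq> 0" using unit[OF V(2)] by auto
  ultimately have e: "lor (D h) (e p) = 0" using lor_commute[of "e p" "D h"] by simp
  have sq: "lor (g3) (g3) * lor (g3) (g3) = 1" using unit' by (metis abs_mult_self_eq mult_1)
  \<comment> \<open>The second factor is the causal sign of \<open>g3\<close>.\<close>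
  let ?k = "lor (D h) (g3) * lor (g3) (g3)"
  have "D h - ?k *\<^sub>R g3 = 0"
    by (rule lor_eq_0_imp_0[OF det])
      (use g e perp' orth sq lor_commute[of "e p" "g3"] in \<open>simp_all add: lor_simps mult.assoc\<close>)
  then show ?thesis by (metis eq_iff_diff_eq_0)
qed

lemma plane_imp_second_kind:
  assumes U: "open U" and surface: "timelike_surface U r"
    and plane: "timelike_plane P" and sub: "r ` U \<subseteq> P"
  shows "pointwise_1_type_second_kind U r"
proof -
  obtain c W where W: "lorentzian_2dim W" and P: "P = (+) c ` W"
    using plane by (auto simp: timelike_plane_def)
  have subW: "subspace W" and dimW: "dim W = 2" using W by (auto simp: lorentzian_2dim_def)
  have tangent: "tangent_space r p = W" if p: "p \<in> U" for p
  proof (rule subspace_dim_equal)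
    have T: "lorentzian_2dim (tangent_space r p)" using surface p by (auto simp: timelike_surface_def)
    then show "subspace (tangent_space r p)" "dim W \<le> dim (tangent_space r p)"
      using dimW by (auto simp: lorentzian_2dim_def)
    show "subspace W" by fact
    show "tangent_space r p \<subseteq> W"
    proof
      fix v assume "v \<in> tangent_space r p"
      then obtain h where v: "v = frechet_derivative r (at p) h" by (auto simp: tangent_space_def)
      have D: "(r has_derivative frechet_derivative r (at p)) (at p)"
        using surface p smooth_on_has_derivative by (auto simp: timelike_surface_def)
      \<comment> \<open>Euclidean normals to \<open>W\<close> are constant along the surface, so
        derivatives lie in the double orthogonal complement of \<open>W\<close>.\<close>
      have "inner l v = 0" if l: "\<And>u. u \<in> W \<Longrightarrow> inner l u = 0" for l
        unfolding v
      proof (rule has_derivative_const_on_open[OF has_derivative_inner_right[OF D] U p])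
        fix y assume "y \<in> U"
        then obtain u where "u \<in> W" "r y = c + u" using sub P by auto
        then show "inner l (r y) = inner l c" using l by (simp add: inner_add_right)
      qed
      then have "v \<in> orthogonal_comp (orthogonal_comp W)"
        unfolding orthogonal_comp_def orthogonal_def by (simp add: inner_commute)
      then show "v \<in> W" using orthogonal_comp_self[OF subW] by simp
    qed
  qed
  have lap: "laplacian r E1 E2 (\<lambda>y. wedge (e3 y) (e4 y)) p = 0"
    if V: "open V" "V \<subseteq> U" and fr: "oriented_frame V r E1 E2 e3 e4" and p: "p \<in> V" for V E1 E2 e3 e4 p
  proof -
    let ?\<nu> = "\<lambda>y. wedge (e3 y) (e4 y)"
    note fr' = fr[unfolded oriented_frame_def]
    have zero: "(?\<nu> has_derivative (\<lambda>h. 0)) (at y)" if y: "y \<in> V" for y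
    proof -
      have D: "(e3 has_derivative frechet_derivative e3 (at y)) (at y)" "(e4 has_derivative frechet_derivative e4 (at y)) (at y)"
        using fr' y smooth_on_has_derivative by blast+
      have perp: "lor (e3 z) g = 0" "lor (e4 z) g = 0" if "z \<in> V" "g \<in> W" for z g
        using fr' tangent[of z] V(2) that by (auto simp: normal_space_def)
      have g: "push r E1 y \<in> W" "push r E2 y \<in> W"
        using tangent[of y] V(2) y by (auto simp: push_def tangent_space_def)
      have u: "\<bar>lor (e3 z) (e3 z)\<bar> = 1" "\<bar>lor (e4 z) (e4 z)\<bar> = 1" "lor (e3 z) (e4 z) = 0" "lor (e4 z) (e3 z) = 0"
        "det (vector [push r E1 z, push r E2 z, e3 z, e4 z] :: real^4^4) > 0" if "z \<in> V" for z
        using fr' that lor_commute[of "e4 z" "e3 z"] by auto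
      have d': "det (vector [push r E1 y, push r E2 y, e4 y, e3 y] :: real^4^4) \<noteq> 0"
        using u(5)[OF y] by (simp add: det_4 algebra_simps)
      have 3: "\<exists>k. frechet_derivative e3 (at y) h = k *\<^sub>R e4 y" for h
        by (rule frame_derivative_parallel[OF V(1) y D(1) u(1) u(2)[OF y] u(3)[OF y]
              perp(1)[OF _ g(1)] perp(1)[OF _ g(2)] perp(2)[OF y g(1)] perp(2)[OF y g(2)]])
          (use u(5)[OF y] in auto)
      have 4: "\<exists>k. frechet_derivative e4 (at y) h = k *\<^sub>R e3 y" for h
        by (rule frame_derivative_parallel[OF V(1) y D(2) u(2) u(1)[OF y] u(4)[OF y]
              perp(2)[OF _ g(1)] perp(2)[OF _ g(2)] perp(1)[OF y g(1)] perp(1)[OF y g(2)] d'])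
      \<comment> \<open>The normals only turn into each other, so each summand is a wedge of
        parallel vectors.\<close>
      have "wedge (e3 y) (frechet_derivative e4 (at y) h) + wedge (frechet_derivative e3 (at y) h) (e4 y) = 0" for h
        using 3[of h] 4[of h] by (auto simp: wedge_simps)
      then show ?thesis
        using bounded_bilinear.FDERIV[OF bounded_bilinear_wedge D] by simp
    qed
    have along0: "along X ?\<nu> y = 0" if "y \<in> V" for X y
      using frechet_derivative_at[OF zero[OF that]] unfolding along_def by metis
    have "along X (along Y ?\<nu>) p = 0" for X Y
    proof -
      have "frechet_derivative (along Y ?\<nu>) (at p) = frechet_derivative (\<lambda>y. 0) (at p)"
        by (rule frechet_derivative_cong_open[OF V(1) p]) (simp add: along0)
      then show ?thesis by (simp add: along_def)
    qed
    then show ?thesis using along0[OF p] by (simp add: laplacian_def)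
  qed
  \<comment> \<open>With \<open>f = 0\<close> any nonzero bivector serves as \<open>C\<close>; a
    coordinate one is chosen.\<close>
  have "gauss_map_eq U r (\<lambda>p. 0) (wedge (axis 1 1) (axis 2 1))"
    unfolding gauss_map_eq_def Let_def by (intro allI impI ballI) (elim conjE, simp only: lap scaleR_zero_left)
  moreover have "(wedge (axis 1 1) (axis 2 1))$1$2 = 1"
    by (simp add: wedge_def axis_def)
  then have "wedge (axis 1 1) (axis 2 1) \<noteq> 0" by (metis zero_index zero_neq_one)
  ultimately show ?thesis
    unfolding pointwise_1_type_second_kind_def
    using smooth_on_const[OF U] wedge_in_bivectors by blast
qed

section \<open>The double rotational surface with \<open>x = 0\<close>\<close>

context double_rotational_surface
begin

text \<open>What remains of the parametrization is hyperbolic polar coordinates in the plane of the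
  last two coordinates. They are injective and continuous, so invariance of domain makes the image
  open in that plane.\<close>

lemma x_eq_0_imp_plane:
  assumes x: "\<And>s. s \<in> I \<Longrightarrow> x s = 0"
  shows "open_part_of_timelike_plane (r ` U)"
proof -
  define P where "P = {v::real^4. \<forall>i. i \<notin> {3, 4} \<longrightarrow> v$i = 0}"
  have P: "v \<in> P \<longleftrightarrow> v$1 = 0 \<and> v$2 = 0" for v
    by (simp add: P_def forall_4)
  have sub: "subspace P" by (auto simp: subspace_def P)
  have dim: "dim P = 2" unfolding P_def using dim_substandard_cart[of "{3, 4 :: 4}", where 'a = real] by (simp add: dim_vec_eq)
  have "lorentzian_2dim P"
    unfolding lorentzian_2dim_def
  proof (intro conjI bexI)
    show "subspace P" "dim P = 2" by fact+
    show "lor (axis 4 1) (axis 4 1) = -1" "lor (axis 3 1) (axis 3 1) = 1" "lor (axis 4 1) (axis 3 1) = 0"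
      by (simp_all add: lor_def axis_def)
    show "axis 4 1 \<in> P" "axis 3 1 \<in> P" by (simp_all add: P axis_def)
  qed
  moreover have "P = (+) 0 ` P" by simp
  ultimately have "timelike_plane P" unfolding timelike_plane_def by blast
  have r: "r p = vector [0, 0, w (fst p) * sinh (b * snd p), w (fst p) * cosh (b * snd p)]" if "p \<in> U" for p
    using that x by (auto simp: double_rot_def)
  have w: "w s \<noteq> 0" if "s \<in> I" for s using immersed[OF that] x[OF that] by auto
  \<comment> \<open>Rolle's theorem and \<open>w1_nonzero\<close> make \<open>w\<close> injective on
    the interval.\<close>
  have no_gap: "\<not> s < s'" if "s \<in> I" "s' \<in> I" "w s = w s'" for s s'
  proof
    assume "s < s'"
    have J: "z \<in> I" if "s \<le> z" "z \<le> s'" for z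
      using interval_I \<open>s \<in> I\<close> \<open>s' \<in> I\<close> that mem_is_interval_1_I by blast
    have "\<exists>z. s < z \<and> z < s' \<and> w1 z = 0"
    proof -
      have "\<exists>z. s < z \<and> z < s' \<and> (\<lambda>v. w1 z * v) = (\<lambda>v. 0)"
      proof (rule Rolle_deriv[OF \<open>s < s'\<close> \<open>w s = w s'\<close>])
        show "continuous_on {s..s'} w"
          using J by (intro continuous_at_imp_continuous_on ballI DERIV_isCont[OF deriv_profile(2)]) auto
        show "(w has_derivative (\<lambda>v. w1 z * v)) (at z)" if "s < z" "z < s'" for z
          using deriv_profile(2)[of z] J that by (simp add: has_field_derivative_def)
      qed
      then obtain z where z: "s < z" "z < s'" "(\<lambda>v. w1 z * v) = (\<lambda>v. 0)" by auto
      from fun_cong[OF z(3), of 1] have "w1 z = 0" by simp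
      with z show ?thesis by blast
    qed
    then show False using w1_nonzero J by force
  qed
  have "inj_on r U"
  proof (rule inj_onI)
    fix p p' assume p: "p \<in> U" "p' \<in> U" and eq: "r p = r p'"
    obtain s t s' t' where pp: "p = (s, t)" "p' = (s', t')" by (cases p; cases p')
    have I: "s \<in> I" "s' \<in> I" using p pp by auto
    have "r p $ 3 = r p' $ 3" "r p $ 4 = r p' $ 4" using eq by simp_all
    then have 3: "w s * sinh (b * t) = w s' * sinh (b * t')" and 4: "w s * cosh (b * t) = w s' * cosh (b * t')"
      using r p pp by simp_all
    \<comment> \<open>The hyperbolic radius is determined up to sign; positivity of
      \<open>cosh\<close> then fixes the sign.\<close>
    have "(w s)\<^sup>2 = (w s')\<^sup>2"
      using 3 4 hyperbolic_pythagoras[of "b * t"] hyperbolic_pythagoras[of "b * t'"] by algebra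
    moreover have "w s \<noteq> - w s'"
    proof
      assume "w s = - w s'"
      then have "w s' * (cosh (b * t) + cosh (b * t')) = 0" using 4 by (simp add: algebra_simps)
      then show False using w[OF I(2)] cosh_real_pos[of "b * t"] cosh_real_pos[of "b * t'"]
        by (simp add: add_eq_0_iff)
    qed
    ultimately have ww: "w s = w s'" by (simp add: power2_eq_iff)
    then have "s = s'" using no_gap[OF I] no_gap[OF I(2,1)] by force
    moreover have "t = t'" using 3 ww w[OF I(2)] b_nonzero by simp
    ultimately show "p = p'" by (simp add: pp)
  qed
  moreover have "continuous_on U r"
    by (intro continuous_at_imp_continuous_on ballI)
      (rule has_derivative_continuous[OF partials_r[unfolded has_partials_def]])
  moreover have "r \<in> U \<rightarrow> P" by (auto simp: r P)
  ultimately have "openin (top_of_set P) (r ` U)"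
    using open_U sub dim
    by (intro invariance_of_domain_subspaces[of UNIV U P]) auto
  then show ?thesis
    using \<open>timelike_plane P\<close> unfolding open_part_of_timelike_plane_def by blast
qed

end

text \<open>Where \<open>x\<close> and \<open>w\<close> both vanish the \<open>t\<close>-derivative
  is zero, so the tangent space is at most one-dimensional.\<close>

lemma timelike_double_rot_imp_immersed:
  assumes "timelike_surface (I \<times> {0<..<2*pi}) (double_rot a b x w)" "s \<in> I"
    and "smooth_on I x" "smooth_on I w" "a \<noteq> 0" "b \<noteq> 0"
  shows "(a * x s)\<^sup>2 + (b * w s)\<^sup>2 > 0"
proof (rule ccontr)
  let ?r = "double_rot a b x w" and ?p = "(s, pi)"
  assume "\<not> (a * x s)\<^sup>2 + (b * w s)\<^sup>2 > 0"
  then have 0: "x s = 0" "w s = 0" using assms(5,6) by (auto simp: sum_power2_gt_zero_iff)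
  have d: "(x has_real_derivative deriv x s) (at (fst ?p))" "(w has_real_derivative deriv w s) (at (fst ?p))"
    using smooth_on_has_real_derivative assms(2-4) by auto
  have "has_partials ?r (moving a b (deriv x s) 0 0 (deriv w s) pi) 0 ?p"
    unfolding double_rot_moving[abs_def]
    by (rule has_partials_cong[OF has_partials_moving[OF d(1) DERIV_const DERIV_const d(2)]])
      (simp_all add: 0 moving_def vec_eq_iff forall_4)
  then have "tangent_space ?r ?p \<subseteq> span {moving a b (deriv x s) 0 0 (deriv w s) pi}"
    by (auto simp: tangent_space_def has_partials_frechet_derivative span_singleton)
  then have "dim (tangent_space ?r ?p) \<le> card {moving a b (deriv x s) 0 0 (deriv w s) pi}"
    by (intro dim_le_card) auto
  moreover have "?p \<in> I \<times> {0<..<2*pi}" using assms(2) by simp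
  then have "dim (tangent_space ?r ?p) = 2"
    using assms(1) unfolding timelike_surface_def lorentzian_2dim_def by blast
  ultimately show False by simp
qed

theorem theorem3p10:
  fixes a b :: real and x w :: "real \<Rightarrow> real" and I :: "real set"
  assumes "open I" and "is_interval I" and "I \<noteq> {}"
    and "smooth_on I x" and "smooth_on I w"
    and "\<forall>s\<in>I. (deriv x s)\<^sup>2 - (deriv w s)\<^sup>2 = -1"
    and "a \<noteq> 0" and "b \<noteq> 0"
    and "timelike_surface (I \<times> {0<..<2*pi}) (double_rot a b x w)"
    and "flat_normal_bundle (I \<times> {0<..<2*pi}) (double_rot a b x w)"
  shows "pointwise_1_type_second_kind (I \<times> {0<..<2*pi}) (double_rot a b x w)
     \<longleftrightarrow> open_part_of_timelike_plane (double_rot a b x w ` (I \<times> {0<..<2*pi}))"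
proof
  interpret double_rotational_surface a b x w I
    using assms timelike_double_rot_imp_immersed[OF assms(9) _ assms(4,5,7,8)]
    by unfold_locales (auto simp: algebra_simps)
  assume "pointwise_1_type_second_kind (I \<times> {0<..<2*pi}) (double_rot a b x w)"
  then obtain f C where fC: "smooth_on U f" "C \<in> bivectors" "C \<noteq> 0" "gauss_map_eq U r f C"
    by (auto simp: pointwise_1_type_second_kind_def)
  have "continuous_on U f" using fC(1) unfolding smooth_on_def by (metis Ck_on.simps(1))
  then show "open_part_of_timelike_plane (double_rot a b x w ` (I \<times> {0<..<2*pi}))"
    by (intro x_eq_0_imp_plane second_kind_imp_x_eq_0[OF fC(4) _ fC(2,3)] flat_normal_bundle_imp[OF assms(10)])
next
  assume "open_part_of_timelike_plane (double_rot a b x w ` (I \<times> {0<..<2*pi}))"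
  then obtain P where P: "timelike_plane P"
      "openin (top_of_set P) (double_rot a b x w ` (I \<times> {0<..<2*pi}))"
    by (auto simp: open_part_of_timelike_plane_def)
  show "pointwise_1_type_second_kind (I \<times> {0<..<2*pi}) (double_rot a b x w)"
    by (rule plane_imp_second_kind[OF _ assms(9) P(1) openin_imp_subset[OF P(2)]])
      (simp add: open_Times assms(1))
qed

end
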